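(* Let $G$ be a quasi-transitive amenable graph. Then the only harmonic Dirichlet functions on $G$ are the constant functions, i.e. every $v\in HD(G)$ is constant.
   Context: Graph means a simple, connected, undirected graph whose vertex degrees are bounded (possibly infinite). $V(G)$ and $E(G)$ are the sets of vertices and edges, and $\vec{E}(G)=\{(x,y)\mid \{x,y\}\in E(G)\}$ is the set of oriented edges. For $e=(x,y)$ write $\bar e=(y,x)$. $l_2(G)$ is the Hilbert space of square-summable functions $u:\vec{E}(G)\to\mathbb{R}$ with $u(\bar e)=-u(e)$, with scalar product $\langle u,u'\rangle=\frac12\sum_{e\in\vec{E}(G)}u(e)u'(e)$. For $v:V(G)\to\mathbb{R}$ the differential $dv:\vec{E}(G)\to\mathbb{R}$ is $dv(x,y)=v(y)-v(x)$. $v$ is a Dirichlet function if $dv\in l_2(G)$. A function $u\in l_2(G)$ is a flow if $\sum_{y:\{x,y\}\in E(G)}u(x,y)=0$ for every $x\in V(G)$. A Dirichlet function $v$ is harmonic if $dv$ is a flow (equivalently, for each vertex $x$, $v(x)$ is the average of $v$ over the neighbors of $x$). $HD(G)$ is the set of harmonic Dirichlet functions. $\delta(x,y)$ denotes the graph distance. A map $f:V(G)\to V(G')$ is a quasi-isomorphism from $G$ to $G'$ if there is a positive number $k$ (the distortion of $f$) such that $\frac1k\delta(x,y)-1<\delta(f(x),f(y))\le k\,\delta(x,y)$ for all $x,y\in V(G)$, and for every $x\in V(G')$ there is $y\in V(G)$ with $\delta(x,f(y))<k$. A graph $G$ is quasi-transitive if there exist quasi-isomorphisms $f_{xy}$ from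 $G$ to $G$, for all vertices $x,y$ of $G$, with $f_{xy}(x)=y$ and with distortions bounded by a common constant. A subgraph of a graph always means a connected full (i.e. induced) subgraph with at least one edge. For a subgraph $G_0$ of $G$, $\sigma(G_0)$ is the set of vertices of $G_0$ that have a neighbor in $G$ outside $G_0$. $G$ is amenable if $\inf |\sigma(G_0)|/|V(G_0)|=0$, the infimum being over finite subgraphs $G_0$ of $G$. *)

theory Defs
  imports "HOL-Analysis.Analysis" "Graph_Theory.Graph_Theory"
begin

text \<open>
  A simple undirected graph is a symmetric loop-free pair digraph: \<^term>\<open>parcs G\<close> is the set of
  oriented edges, both orientations of each edge being present. The locales
  \<^locale>\<open>pair_graph\<close> and \<^locale>\<open>graph\<close> are not used because they require finiteness.
\<close>

locale bounded_degree_graph = pair_bidirected_digraph G for G :: "'a pair_pre_digraph" +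
  assumes connected_G: "Digraph_Component.connected (with_proj G)"
    and bounded_degree: "\<exists>d. \<forall>x \<in> pverts G.
      finite (out_arcs (with_proj G) x) \<and> out_degree (with_proj G) x \<le> d"

text \<open>
  Functions on oriented edges or on vertices are total HOL functions whose values outside
  \<^term>\<open>parcs G\<close> and \<^term>\<open>pverts G\<close>, respectively, are irrelevant.
\<close>

definition l2 :: "'a pair_pre_digraph \<Rightarrow> ('a \<times> 'a \<Rightarrow> real) set" where
  "l2 G = {u. (\<forall>(x, y) \<in> parcs G. u (y, x) = - u (x, y)) \<and>
              (\<lambda>e. (u e)\<^sup>2) summable_on parcs G}"

definition differential :: "('a \<Rightarrow> real) \<Rightarrow> 'a \<times> 'a \<Rightarrow> real" where
  "differential v = (\<lambda>(x, y). v y - v x)"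

definition dirichlet_function :: "'a pair_pre_digraph \<Rightarrow> ('a \<Rightarrow> real) \<Rightarrow> bool" where
  "dirichlet_function G v \<longleftrightarrow> differential v \<in> l2 G"

definition flow :: "'a pair_pre_digraph \<Rightarrow> ('a \<times> 'a \<Rightarrow> real) \<Rightarrow> bool" where
  "flow G u \<longleftrightarrow> u \<in> l2 G \<and> (\<forall>x \<in> pverts G. (\<Sum>y \<in> {y. (x, y) \<in> parcs G}. u (x, y)) = 0)"

definition HD :: "'a pair_pre_digraph \<Rightarrow> ('a \<Rightarrow> real) set" where
  "HD G = {v. dirichlet_function G v \<and> flow G (differential v)}"

definition graph_dist :: "'a pair_pre_digraph \<Rightarrow> 'a \<Rightarrow> 'a \<Rightarrow> nat" where
  "graph_dist G x y = (INF p \<in> {p. pre_digraph.awalk (with_proj G) x p y}. length p)"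

definition quasi_isomorphism ::
    "real \<Rightarrow> 'a pair_pre_digraph \<Rightarrow> 'b pair_pre_digraph \<Rightarrow> ('a \<Rightarrow> 'b) \<Rightarrow> bool" where
  "quasi_isomorphism k G G' f \<longleftrightarrow>
     k > 0 \<and> f ` pverts G \<subseteq> pverts G' \<and>
     (\<forall>x \<in> pverts G. \<forall>y \<in> pverts G.
        1 / k * real (graph_dist G x y) - 1 < real (graph_dist G' (f x) (f y)) \<and>
        real (graph_dist G' (f x) (f y)) \<le> k * real (graph_dist G x y)) \<and>
     (\<forall>x \<in> pverts G'. \<exists>y \<in> pverts G. real (graph_dist G' x (f y)) < k)"

definition quasi_transitive :: "'a pair_pre_digraph \<Rightarrow> bool" where
  "quasi_transitive G \<longleftrightarrow>
     (\<exists>K. \<forall>x \<in> pverts G. \<forall>y \<in> pverts G. \<exists>f k.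
        k \<le> K \<and> quasi_isomorphism k G G f \<and> f x = y)"

definition full_subgraph :: "'a pair_pre_digraph \<Rightarrow> 'a pair_pre_digraph \<Rightarrow> bool" where
  "full_subgraph H G \<longleftrightarrow>
     induced_subgraph (with_proj H) (with_proj G) \<and>
     Digraph_Component.connected (with_proj H) \<and> parcs H \<noteq> {}"

definition vertex_boundary :: "'a pair_pre_digraph \<Rightarrow> 'a pair_pre_digraph \<Rightarrow> 'a set" where
  "vertex_boundary G H = {x \<in> pverts H. \<exists>y. (x, y) \<in> parcs G \<and> y \<notin> pverts H}"

text \<open>
  The infimum is taken in \<^typ>\<open>ereal\<close>, so that it is \<open>\<infinity>\<close> for the one-vertex graph,
  which has no subgraph with an edge.
\<close>

definition amenable :: "'a pair_pre_digraph \<Rightarrow> bool" where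
  "amenable G \<longleftrightarrow>
     (INF H \<in> {H. full_subgraph H G \<and> finite (pverts H)}.
        ereal (real (card (vertex_boundary G H)) / real (card (pverts H)))) = 0"

end

theory Submission
  imports Defs
begin

text \<open>The proof compares two estimates of the trace of the orthogonal projection onto differentials of
  harmonic functions, taken over the arcs inside a finite vertex set \<open>F\<close>.

  From above: a function that is harmonic at every vertex of \<open>F\<close> off the inner boundary
  \<open>\<sigma>(F)\<close> is determined by its values on \<open>\<sigma>(F)\<close>, so these functions form a space of dimension
  at most \<open>|\<sigma>(F)|\<close>. The trace of the projection onto their differentials is
  \<open>\<Sum>e. K e\<close>, where \<open>K e\<close> is the largest value of \<open>(dw e)\<^sup>2\<close> for \<open>w\<close> in the
  space with unit energy; so \<open>\<Sum>e. K e \<le> |\<sigma>(F)|\<close>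
  (\<open>ex_harmonic_inside_evaluation_bound\<close>).

  From below: let \<open>v\<close> be a nonconstant harmonic Dirichlet function and \<open>x0\<close> a base vertex. For
  every vertex \<open>x\<close> take a quasi-isomorphism \<open>f\<close> of bounded distortion with \<open>f x = x0\<close>, and
  replace \<open>v \<circ> f\<close> inside \<open>F\<close> by the function \<open>w\<close> that is harmonic there and has the same values
  on \<open>\<sigma>(F)\<close>. The energy of \<open>w\<close> is at most that of \<open>v \<circ> f\<close>, hence bounded independently of \<open>x\<close>
  and \<open>F\<close>. The crucial point (\<open>uniform_local_energy\<close>) is that \<open>w\<close> keeps an amount \<open>c > 0\<close>
  of energy within a fixed distance \<open>R\<close> of \<open>x\<close>. Indeed, let \<open>h\<close> be a coarse inverse of
  \<open>f\<close>. Then \<open>v - w \<circ> h\<close> is the sum of \<open>v - v \<circ> f \<circ> h\<close>, which is square summable because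
  \<open>f \<circ> h\<close> moves points a bounded distance, and a finitely supported function. As \<open>dv\<close> is a
  flow, it is orthogonal to the differential of every square summable function, so the inner
  product of \<open>dv\<close> with \<open>d(w \<circ> h)\<close> equals that of \<open>dv\<close> with itself. All but a small part of the energy
  of \<open>v\<close> lies in some ball around \<open>x0\<close>, so \<open>d(w \<circ> h)\<close> cannot be small near \<open>x0\<close>, which means that
  \<open>dw\<close> cannot be small near \<open>h x0\<close>, a vertex close to \<open>x\<close>.

  Each \<open>w\<close> satisfies \<open>(dw e)\<^sup>2 \<le> Q K e\<close>, where \<open>Q\<close> is the common bound for the energies, so
  the sum of \<open>K\<close> over the arcs within distance \<open>R\<close> of \<open>x\<close> is at least \<open>c / Q\<close>.
  Summing over \<open>x\<close> and comparing with the estimate from above, the number of vertices of \<open>F\<close>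
  at distance more than \<open>R\<close> from \<open>\<sigma>(F)\<close> is at most a constant times \<open>|\<sigma>(F)|\<close>. The remaining vertices of \<open>F\<close> also number at
  most a constant times \<open>|\<sigma>(F)|\<close>, since balls of radius \<open>R\<close> have bounded size. Thus a nonconstant
  harmonic Dirichlet function forces a strong isoperimetric inequality
  (\<open>strong_isoperimetric_inequality\<close>), which contradicts amenability.\<close>

section \<open>Sums and differentials\<close>

text \<open>Double counting: after exchanging the sums, \<open>g e\<close> occurs once for each \<open>i\<close> with
  \<open>e \<in> N i\<close>, that is at most \<open>M\<close> times.\<close>

lemma sum_Union_le_multiplicity:
  fixes g :: "'e \<Rightarrow> real"
  assumes "finite I" "finite U"
    and sub: "\<And>i. i \<in> I \<Longrightarrow> N i \<subseteq> U"
    and nonneg: "\<And>e. e \<in> U \<Longrightarrow> g e \<ge> 0"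
    and mult: "\<And>e. e \<in> U \<Longrightarrow> card {i \<in> I. e \<in> N i} \<le> M"
  shows "(\<Sum>i\<in>I. \<Sum>e\<in>N i. g e) \<le> real M * (\<Sum>e\<in>U. g e)"
proof -
  have "(\<Sum>i\<in>I. \<Sum>e\<in>N i. g e) = (\<Sum>i\<in>I. \<Sum>e\<in>U. if e \<in> N i then g e else 0)"
  proof (rule sum.cong[OF refl])
    fix i assume "i \<in> I"
    then show "(\<Sum>e\<in>N i. g e) = (\<Sum>e\<in>U. if e \<in> N i then g e else 0)"
      using sub[of i] assms(2) by (simp add: sum.inter_restrict[symmetric] Int_absorb1)
  qed
  also have "\<dots> = (\<Sum>e\<in>U. \<Sum>i\<in>I. if e \<in> N i then g e else 0)"
    by (rule sum.swap)
  also have "\<dots> = (\<Sum>e\<in>U. real (card {i \<in> I. e \<in> N i}) * g e)"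
    using assms(1) by (intro sum.cong) (auto simp: sum.If_cases Int_def)
  also have "\<dots> \<le> (\<Sum>e\<in>U. real M * g e)"
    using mult nonneg by (intro sum_mono mult_right_mono) auto
  finally show ?thesis
    by (simp add: sum_distrib_left)
qed

lemma differential_pair [simp]: "differential u (x, y) = u y - u x"
  by (simp add: differential_def)

lemma differential_diff: "differential (\<lambda>x. u x - t * w x) e = differential u e - t * differential w e"
  by (cases e) (simp add: algebra_simps)

section \<open>Relations of bounded valency and local energy estimates\<close>

text \<open>The analysis needs only the arcs, so it is done for a symmetric relation of bounded valency;
  vertices enter as elements of \<^term>\<open>Domain A\<close>.\<close>

locale bounded_valency_relation =
  fixes A :: "('a \<times> 'a) set" and d :: nat
  assumes sym_A: "sym A"
    and finite_nbrs: "finite (A `` {x})"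
    and card_nbrs: "card (A `` {x}) \<le> d"
begin

definition nball :: "nat \<Rightarrow> 'a \<Rightarrow> 'a set" where
  "nball n x = ((A\<^sup>=) ^^ n) `` {x}"

definition arcs_near :: "nat \<Rightarrow> 'a \<Rightarrow> ('a \<times> 'a) set" where
  "arcs_near n x = {e \<in> A. fst e \<in> nball n x}"

lemma nball_0 [simp]: "nball 0 x = {x}"
  by (auto simp: nball_def)

lemma nball_Suc: "nball (Suc n) x = (\<Union>y \<in> nball n x. insert y (A `` {y}))"
  by (auto simp: nball_def)

lemma nball_1: "nball (Suc 0) x = insert x (A `` {x})"
  by (simp add: nball_Suc)

lemma nball_sym: "y \<in> nball n x \<longleftrightarrow> x \<in> nball n y"
proof -
  have conv: "(A\<^sup>=)\<inverse> = A\<^sup>="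
    using sym_A by (auto simp: sym_def)
  have "((A\<^sup>=) ^^ n)\<inverse> = (A\<^sup>=) ^^ n"
  proof (induction n)
    case (Suc n)
    then show ?case
      by (simp only: relpow.simps converse_relcomp conv relpow_commute)
  qed simp
  then have "(x, y) \<in> (A\<^sup>=) ^^ n \<longleftrightarrow> (y, x) \<in> (A\<^sup>=) ^^ n"
    by blast
  then show ?thesis
    by (simp add: nball_def)
qed

lemma nball_trans: "y \<in> nball m x \<Longrightarrow> z \<in> nball n y \<Longrightarrow> z \<in> nball (m + n) x"
  by (auto simp: nball_def relpow_add)

lemma nball_mono: "m \<le> n \<Longrightarrow> nball m x \<subseteq> nball n x"
  by (rule lift_Suc_mono_le[of "\<lambda>n. nball n x"]) (auto simp: nball_Suc)

lemma finite_nball: "finite (nball n x)"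
  by (induction n) (auto simp: nball_Suc finite_nbrs)

lemma card_nball: "card (nball n x) \<le> (d + 1) ^ n"
proof (induction n)
  case (Suc n)
  have "card (nball (Suc n) x) \<le> (\<Sum>y\<in>nball n x. card (insert y (A `` {y})))"
    unfolding nball_Suc by (rule card_UN_le) (rule finite_nball)
  also have "\<dots> \<le> (\<Sum>y\<in>nball n x. d + 1)"
  proof (rule sum_mono)
    fix y show "card (insert y (A `` {y})) \<le> d + 1"
      using card_insert_le_m1[of "d + 1" "A `` {y}" y] card_nbrs[of y] by simp
  qed
  also have "\<dots> \<le> (d + 1) ^ Suc n"
    using mult_right_mono[OF Suc.IH, of "d + 1"] by (simp add: algebra_simps)
  finally show ?case .
qed simp

lemma arc_in_nball: "(x, y) \<in> A \<Longrightarrow> y \<in> nball (Suc 0) x"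
  by (simp add: nball_1)

lemma finite_arcs_near: "finite (arcs_near n x)"
proof (rule finite_subset)
  show "arcs_near n x \<subseteq> (SIGMA y : nball n x. A `` {y})"
    by (auto simp: arcs_near_def)
qed (auto simp: finite_nball finite_nbrs)

lemma arcs_near_mono: "m \<le> n \<Longrightarrow> arcs_near m x \<subseteq> arcs_near n x"
  using nball_mono by (auto simp: arcs_near_def)

lemma arcs_near_trans: "y \<in> nball m x \<Longrightarrow> arcs_near n y \<subseteq> arcs_near (m + n) x"
  using nball_trans by (auto simp: arcs_near_def)

lemma swap_arcs: "prod.swap ` A = A"
  using sym_A by (force simp: sym_def image_iff)

lemma card_arcs_from: "card {e \<in> A. fst e = x} \<le> d" "finite {e \<in> A. fst e = x}"
proof -
  have "{e \<in> A. fst e = x} = Pair x ` (A `` {x})" by auto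
  then show "card {e \<in> A. fst e = x} \<le> d" "finite {e \<in> A. fst e = x}"
    using card_nbrs[of x] finite_nbrs[of x] by (auto simp: card_image inj_on_def)
qed

text \<open>Each step of a walk from \<open>a\<close> to \<open>b\<close> costs a factor, by \<open>(s + t)\<^sup>2 \<le> 2 s\<^sup>2 + 2 t\<^sup>2\<close>.
  Cauchy-Schwarz along a shortest walk would give \<open>n\<close> in place of \<open>4 ^ n\<close>, but only the
  independence of the constant from \<open>a\<close> and \<open>u\<close> matters.\<close>

lemma sq_diff_le_energy_near:
  assumes "b \<in> nball n a"
  shows "(u b - u a)\<^sup>2 \<le> 4 ^ n * (\<Sum>e\<in>arcs_near n a. (differential u e)\<^sup>2)"
  using assms
proof (induction n arbitrary: b)
  case (Suc n)
  let ?S = "\<lambda>n. \<Sum>e\<in>arcs_near n a. (differential u e)\<^sup>2"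
  have mono: "?S n \<le> ?S (Suc n)"
    by (intro sum_mono2 finite_arcs_near arcs_near_mono) auto
  have nonneg: "0 \<le> ?S (Suc n)" by (rule sum_nonneg) simp
  from Suc.prems obtain c where c: "c \<in> nball n a" and cb: "b = c \<or> (c, b) \<in> A"
    by (auto simp: nball_Suc)
  have step: "(u b - u c)\<^sup>2 \<le> ?S (Suc n)"
  proof (cases "b = c")
    case False
    then have "(c, b) \<in> arcs_near (Suc n) a"
      using cb c nball_mono[of n "Suc n" a] by (auto simp: arcs_near_def)
    then have "(differential u (c, b))\<^sup>2 \<le> ?S (Suc n)"
      by (intro member_le_sum finite_arcs_near) auto
    then show ?thesis by simp
  qed (simp add: nonneg)
  have "(u b - u a)\<^sup>2 \<le> 2 * (u c - u a)\<^sup>2 + 2 * (u b - u c)\<^sup>2"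
    using sum_squares_ge_zero[of "(u c - u a) - (u b - u c)" 0]
    by (simp add: power2_eq_square algebra_simps)
  also have "\<dots> \<le> 2 * (4 ^ n * ?S (Suc n)) + 2 * (4 ^ n * ?S (Suc n))"
  proof (intro add_mono mult_left_mono)
    show "(u c - u a)\<^sup>2 \<le> 4 ^ n * ?S (Suc n)"
      using Suc.IH[OF c] mono by (meson mult_left_mono order_trans zero_le_numeral zero_le_power)
    show "(u b - u c)\<^sup>2 \<le> 4 ^ n * ?S (Suc n)"
      using step mult_right_mono[of 1 "4 ^ n" "?S (Suc n)"] nonneg by simp
  qed simp_all
  finally show ?case by simp
qed (simp add: sum_nonneg)

definition chain_const :: "nat \<Rightarrow> nat \<Rightarrow> real" where
  "chain_const n M = 4 ^ n * real ((d + 1) ^ n * M)"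

text \<open>The common source of all energy estimates for coarse maps. An arc is close to boundedly many
  vertices, and each vertex is \<open>a i\<close> for at most \<open>M\<close> indices, so summing the previous estimate
  over \<open>I\<close> uses every arc a bounded number of times.\<close>

lemma sum_sq_diff_le_energy_near:
  assumes "finite I"
    and near: "\<And>i. i \<in> I \<Longrightarrow> b i \<in> nball n (a i)"
    and mult: "\<And>z. card {i \<in> I. a i = z} \<le> M"
  shows "(\<Sum>i\<in>I. (u (b i) - u (a i))\<^sup>2) \<le>
    chain_const n M * (\<Sum>e \<in> (\<Union>i\<in>I. arcs_near n (a i)). (differential u e)\<^sup>2)"
proof -
  let ?U = "\<Union>i\<in>I. arcs_near n (a i)"
  have "(\<Sum>i\<in>I. (u (b i) - u (a i))\<^sup>2) \<le>
      (\<Sum>i\<in>I. 4 ^ n * (\<Sum>e\<in>arcs_near n (a i). (differential u e)\<^sup>2))"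
    by (intro sum_mono sq_diff_le_energy_near near)
  also have "\<dots> = 4 ^ n * (\<Sum>i\<in>I. \<Sum>e\<in>arcs_near n (a i). (differential u e)\<^sup>2)"
    by (simp add: sum_distrib_left)
  also have "(\<Sum>i\<in>I. \<Sum>e\<in>arcs_near n (a i). (differential u e)\<^sup>2) \<le>
      real ((d + 1) ^ n * M) * (\<Sum>e\<in>?U. (differential u e)\<^sup>2)"
  proof (rule sum_Union_le_multiplicity)
    show "finite ?U" using assms(1) finite_arcs_near by blast
    fix e assume "e \<in> ?U"
    have "{i \<in> I. e \<in> arcs_near n (a i)} \<subseteq> (\<Union>z \<in> nball n (fst e). {i \<in> I. a i = z})"
      using nball_sym by (auto simp: arcs_near_def)
    then have "card {i \<in> I. e \<in> arcs_near n (a i)} \<le> card (\<Union>z \<in> nball n (fst e). {i \<in> I. a i = z})"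
      using assms(1) finite_nball by (intro card_mono) auto
    also have "\<dots> \<le> (\<Sum>z \<in> nball n (fst e). card {i \<in> I. a i = z})"
      by (intro card_UN_le finite_nball)
    also have "\<dots> \<le> (\<Sum>z \<in> nball n (fst e). M)"
      by (intro sum_mono mult)
    also have "\<dots> \<le> (d + 1) ^ n * M"
      using card_nball[of n "fst e"] by simp
    finally show "card {i \<in> I. e \<in> arcs_near n (a i)} \<le> (d + 1) ^ n * M" .
  qed (use assms(1) in auto)
  finally show ?thesis
    by (simp add: mult.assoc chain_const_def)
qed

definition energy :: "('a \<Rightarrow> real) \<Rightarrow> real" where
  "energy u = (\<Sum>\<^sub>\<infinity>e\<in>A. (differential u e)\<^sup>2)"

definition finite_energy :: "('a \<Rightarrow> real) \<Rightarrow> bool" where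
  "finite_energy u \<longleftrightarrow> (\<lambda>e. (differential u e)\<^sup>2) summable_on A"

lemma energy_nonneg: "0 \<le> energy u"
  by (simp add: energy_def infsum_nonneg)

lemma sum_sq_le_energy:
  assumes "finite_energy u" "finite X" "X \<subseteq> A"
  shows "(\<Sum>e\<in>X. (differential u e)\<^sup>2) \<le> energy u"
  using assms unfolding energy_def finite_energy_def by (intro finite_sum_le_infsum) auto

lemma chain_const_nonneg: "0 \<le> chain_const n M"
  by (simp add: chain_const_def)

lemma infsum_sq_diff_le_energy:
  assumes fin: "finite_energy u"
    and near: "\<And>i. i \<in> I \<Longrightarrow> b i \<in> nball n (a i)"
    and mult: "\<And>z. finite {i \<in> I. a i = z} \<and> card {i \<in> I. a i = z} \<le> M"
  shows "(\<lambda>i. (u (b i) - u (a i))\<^sup>2) summable_on I" (is "?f summable_on I")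
    and "(\<Sum>\<^sub>\<infinity>i\<in>I. (u (b i) - u (a i))\<^sup>2) \<le> chain_const n M * energy u"
proof -
  have bound: "sum ?f X \<le> chain_const n M * energy u" if X: "finite X" "X \<subseteq> I" for X
  proof -
    have "sum ?f X \<le> chain_const n M *
        (\<Sum>e \<in> (\<Union>i\<in>X. arcs_near n (a i)). (differential u e)\<^sup>2)"
    proof (rule sum_sq_diff_le_energy_near)
      fix z
      have "card {i \<in> X. a i = z} \<le> card {i \<in> I. a i = z}"
        using X mult by (intro card_mono) auto
      then show "card {i \<in> X. a i = z} \<le> M" using mult[of z] by simp
    qed (use X near in auto)
    also have "\<dots> \<le> chain_const n M * energy u"
      using X finite_arcs_near fin
      by (intro mult_left_mono sum_sq_le_energy chain_const_nonneg) (auto simp: arcs_near_def)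
    finally show ?thesis .
  qed
  show *: "?f summable_on I"
    using bound by (intro nonneg_bdd_above_summable_on) (auto simp: bdd_above_def)
  show "infsum ?f I \<le> chain_const n M * energy u"
    by (rule infsum_le_finite_sums[OF * bound])
qed

text \<open>Summation by parts. Square summability of \<open>\<phi>\<close> itself, not only of its differential, makes
  the two halves \<open>dv(x, y) \<phi> y\<close> and \<open>dv(x, y) \<phi> x\<close> separately absolutely summable; each half
  then vanishes by summing around every vertex first. For a Dirichlet function \<open>\<phi>\<close> without this
  property the conclusion may fail: \<open>\<phi> = v\<close> gives the energy of \<open>v\<close>.\<close>

lemma Green_harmonic:
  assumes fin: "finite_energy v"
    and harm: "\<And>x. (\<Sum>y \<in> A `` {x}. v y - v x) = 0"
    and phi: "(\<lambda>x. (\<phi> x)\<^sup>2) summable_on Domain A"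
  shows "(\<lambda>e. differential v e * differential \<phi> e) summable_on A"
    and "(\<Sum>\<^sub>\<infinity>e\<in>A. differential v e * differential \<phi> e) = 0"
proof -
  let ?p = "\<lambda>e. differential v e * \<phi> (fst e)"
  have phi_arcs: "(\<lambda>e. (\<phi> (fst e))\<^sup>2) summable_on A"
  proof (rule nonneg_bdd_above_summable_on)
    have "(\<Sum>e\<in>X. (\<phi> (fst e))\<^sup>2) \<le> real d * (\<Sum>\<^sub>\<infinity>x\<in>Domain A. (\<phi> x)\<^sup>2)"
      if X: "finite X" "X \<subseteq> A" for X
    proof -
      have "(\<Sum>e\<in>X. (\<phi> (fst e))\<^sup>2) = (\<Sum>e\<in>X. \<Sum>x\<in>{fst e}. (\<phi> x)\<^sup>2)" by simp
      also have "\<dots> \<le> real d * (\<Sum>x\<in>fst ` X. (\<phi> x)\<^sup>2)"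
      proof (rule sum_Union_le_multiplicity)
        fix x
        have "card {e \<in> X. x \<in> {fst e}} \<le> card {e \<in> A. fst e = x}"
          using X card_arcs_from by (intro card_mono) auto
        then show "card {e \<in> X. x \<in> {fst e}} \<le> d"
          using card_arcs_from(1)[of x] by simp
      qed (use X in auto)
      also have "(\<Sum>x\<in>fst ` X. (\<phi> x)\<^sup>2) \<le> (\<Sum>\<^sub>\<infinity>x\<in>Domain A. (\<phi> x)\<^sup>2)"
        using X by (intro finite_sum_le_infsum phi) (auto simp: Domain_fst)
      finally show ?thesis by (simp add: mult_left_mono)
    qed
    then show "bdd_above (sum (\<lambda>e. (\<phi> (fst e))\<^sup>2) ` {F. F \<subseteq> A \<and> finite F})"
      by (auto simp: bdd_above_def)
  qed simp
  have p: "?p summable_on A"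
  proof -
    have "(\<lambda>e. (differential v e)\<^sup>2 + (\<phi> (fst e))\<^sup>2) summable_on A"
      using fin phi_arcs by (intro summable_on_add) (auto simp: finite_energy_def)
    then have "(\<lambda>e. norm (?p e)) summable_on A"
    proof (rule summable_on_comparison_test)
      fix e :: "'a \<times> 'a"
      have "2 * \<bar>s * t\<bar> \<le> s\<^sup>2 + t\<^sup>2" for s t :: real
        using sum_squares_ge_zero[of "\<bar>s\<bar> - \<bar>t\<bar>" 0] 
        by (simp add: power2_eq_square algebra_simps abs_mult)
      from this[of "differential v e" "\<phi> (fst e)"] 
      show "norm (?p e) \<le> (differential v e)\<^sup>2 + (\<phi> (fst e))\<^sup>2" 
        by simp
    qed simp
    then show ?thesis by (rule abs_summable_summable)
  qed
  have Sig: "A = (SIGMA x : Domain A. A `` {x})" by auto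
  have p0: "infsum ?p A = 0"
  proof -
    have "infsum ?p A = (\<Sum>\<^sub>\<infinity>x\<in>Domain A. \<Sum>\<^sub>\<infinity>y\<in>A `` {x}. ?p (x, y))"
      using infsum_Sigma_banach[of ?p "Domain A" "\<lambda>x. A `` {x}"] p Sig by simp
    also have "\<dots> = (\<Sum>\<^sub>\<infinity>x\<in>Domain A. 0)"
    proof (rule infsum_cong)
      fix x
      have "(\<Sum>\<^sub>\<infinity>y\<in>A `` {x}. ?p (x, y)) = (\<Sum>y\<in>A `` {x}. v y - v x) * \<phi> x"
        by (simp add: finite_nbrs sum_distrib_right)
      then show "(\<Sum>\<^sub>\<infinity>y\<in>A `` {x}. ?p (x, y)) = 0" by (simp add: harm)
    qed
    finally show ?thesis by simp
  qed
  let ?q = "\<lambda>e. differential v e * \<phi> (snd e)"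
  have bij: "bij_betw prod.swap A A"
    using swap_arcs by (auto simp: bij_betw_def)
  have q_swap: "?q (prod.swap e) = - ?p e" for e
    by (cases e) (simp add: algebra_simps)
  have q: "?q summable_on A"
    using summable_on_reindex_bij_betw[OF bij, of ?q] p
    by (simp only: q_swap summable_on_uminus)
  have q0: "infsum ?q A = 0"
    using infsum_reindex_bij_betw[OF bij, of ?q] p0
    by (simp only: q_swap infsum_uminus)
  have split: "differential v e * differential \<phi> e = ?q e + - ?p e" for e
    by (cases e) (simp add: algebra_simps)
  show "(\<lambda>e. differential v e * differential \<phi> e) summable_on A"
    unfolding split using p q by (intro summable_on_add) (simp_all add: summable_on_uminus)
  show "(\<Sum>\<^sub>\<infinity>e\<in>A. differential v e * differential \<phi> e) = 0"
    unfolding split using p q p0 q0 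
    by (subst infsum_add) (simp_all add: summable_on_uminus infsum_uminus)
qed

end

section \<open>Finite-dimensional orthogonal projection\<close>

text \<open>Twice the restriction to \<open>E\<close> of the inner product of differentials when \<open>E\<close> contains both
  orientations of its edges.\<close>

definition dirichlet_form :: "('a \<times> 'a) set \<Rightarrow> ('a \<Rightarrow> real) \<Rightarrow> ('a \<Rightarrow> real) \<Rightarrow> real" where
  "dirichlet_form E u w = (\<Sum>e\<in>E. differential u e * differential w e)"

lemma dirichlet_form_commute: "dirichlet_form E u w = dirichlet_form E w u"
  by (simp add: dirichlet_form_def mult.commute)

lemma dirichlet_form_diff_left:
  "dirichlet_form E (\<lambda>x. u x - t * w x) z = dirichlet_form E u z - t * dirichlet_form E w z"
  by (simp add: dirichlet_form_def differential_diff algebra_simps sum_subtractf sum_distrib_left)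

lemma dirichlet_form_diff_right:
  "dirichlet_form E z (\<lambda>x. u x - t * w x) = dirichlet_form E z u - t * dirichlet_form E z w"
  using dirichlet_form_diff_left[of E u t w z] by (simp add: dirichlet_form_commute)

lemma dirichlet_form_self: "dirichlet_form E u u = (\<Sum>e\<in>E. (differential u e)\<^sup>2)"
  by (simp add: dirichlet_form_def power2_eq_square)

lemma dirichlet_form_self_nonneg: "0 \<le> dirichlet_form E u u"
  by (simp add: dirichlet_form_self sum_nonneg)

lemma differential_eq_0_if_dirichlet_form_eq_0:
  assumes "finite E" "dirichlet_form E u u = 0" "e \<in> E"
  shows "differential u e = 0"
  using assms by (simp add: dirichlet_form_self sum_nonneg_eq_0_iff)

lemma dirichlet_form_eq_0_if_self_eq_0:
  assumes "finite E" "dirichlet_form E u u = 0"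
  shows "dirichlet_form E u w = 0"
  using differential_eq_0_if_dirichlet_form_eq_0[OF assms] by (simp add: dirichlet_form_def)

lemma dirichlet_form_cong:
  assumes "\<And>e. e \<in> E \<Longrightarrow> differential w e = differential w' e"
  shows "dirichlet_form E u w = dirichlet_form E u w'"
  using assms by (simp add: dirichlet_form_def)

text \<open>The correction \<open>g\<close> that makes \<open>u - g\<close> harmonic on \<open>I\<close>, that is, the solution of the
  Dirichlet problem in weak form. It is found by Gram-Schmidt orthogonalisation of the unit masses
  at the points of \<open>I\<close>.\<close>

lemma ex_finitely_supported_projection:
  fixes u :: "'a \<Rightarrow> real"
  assumes "finite I" "finite E"
  shows "\<exists>g. (\<forall>x. x \<notin> I \<longrightarrow> g x = 0) \<and>
    (\<forall>g'. (\<forall>x. x \<notin> I \<longrightarrow> g' x = 0) \<longrightarrow> dirichlet_form E (\<lambda>x. u x - g x) g' = 0)"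
  using assms(1)
proof (induction I arbitrary: u)
  case empty
  show ?case
  proof (intro exI conjI allI impI)
    fix g' :: "'a \<Rightarrow> real" assume "\<forall>x. x \<notin> {} \<longrightarrow> g' x = 0"
    then have "g' = (\<lambda>x. 0)" by auto
    then show "dirichlet_form E (\<lambda>x. u x - (\<lambda>_. 0) x) g' = 0"
      by (simp add: dirichlet_form_def differential_def split_beta)
  qed simp
next
  case (insert j I)
  from insert.IH[of u] obtain g where g: "\<And>x. x \<notin> I \<Longrightarrow> g x = 0"
    and g_orth: "\<And>g'. (\<forall>x. x \<notin> I \<longrightarrow> g' x = 0) \<Longrightarrow> dirichlet_form E (\<lambda>x. u x - g x) g' = 0"
    by auto
  from insert.IH[of "\<lambda>x. if x = j then 1 else 0"] obtain p where p: "\<And>x. x \<notin> I \<Longrightarrow> p x = 0"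
    and p_orth: "\<And>g'. (\<forall>x. x \<notin> I \<longrightarrow> g' x = 0) \<Longrightarrow>
      dirichlet_form E (\<lambda>x. (if x = j then 1 else 0) - p x) g' = 0"
    by auto
  \<comment> \<open>the part of the unit mass at \<open>j\<close> that is orthogonal to the functions supported on \<open>I\<close>\<close>
  define q where "q x = (if x = j then 1 else 0) - p x" for x
  \<comment> \<open>The form is only semidefinite: if \<open>q\<close> has zero energy, it is orthogonal to everything, and
    division by zero gives the right value \<open>t = 0\<close>.\<close>
  define t where "t = dirichlet_form E (\<lambda>x. u x - g x) q / dirichlet_form E q q"
  have qj: "q j = 1" using p[of j] insert.hyps by (simp add: q_def)
  have q0: "q x = 0" if "x \<notin> insert j I" for x using p[of x] that by (simp add: q_def)
  have ug: "(\<lambda>x. u x - (g x + t * q x)) = (\<lambda>x. (\<lambda>x. u x - g x) x - t * q x)"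
    by (auto simp: algebra_simps)
  have orth_q: "dirichlet_form E (\<lambda>x. u x - (g x + t * q x)) q = 0"
  proof (cases "dirichlet_form E q q = 0")
    case True
    then have "dirichlet_form E (\<lambda>x. u x - g x) q = 0"
      using dirichlet_form_eq_0_if_self_eq_0[OF assms(2)] dirichlet_form_commute by metis
    with True show ?thesis unfolding ug dirichlet_form_diff_left by simp
  next
    case False
    then show ?thesis unfolding ug dirichlet_form_diff_left by (simp add: t_def)
  qed
  show ?case
  proof (intro exI[of _ "\<lambda>x. g x + t * q x"] conjI allI impI)
    fix x assume "x \<notin> insert j I"
    then show "g x + t * q x = 0" using g[of x] q0[of x] by simp
  next
    fix g' :: "'a \<Rightarrow> real" assume g': "\<forall>x. x \<notin> insert j I \<longrightarrow> g' x = 0"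
    define g'' where "g'' x = g' x - g' j * q x" for x
    have g'': "\<forall>x. x \<notin> I \<longrightarrow> g'' x = 0"
    proof (intro allI impI)
      fix x assume "x \<notin> I"
      then show "g'' x = 0"
        using g' q0[of x] qj by (cases "x = j") (auto simp: g''_def)
    qed
    have "dirichlet_form E (\<lambda>x. u x - (g x + t * q x)) g'' = 0"
      unfolding ug dirichlet_form_diff_left using g_orth[OF g''] p_orth[OF g''] by (simp add: q_def[abs_def])
    moreover have "g'' = (\<lambda>x. g' x - g' j * q x)" by (auto simp: g''_def)
    ultimately show "dirichlet_form E (\<lambda>x. u x - (g x + t * q x)) g' = 0"
      using orth_q by (simp add: dirichlet_form_diff_right)
  qed
qed

text \<open>Cauchy-Schwarz for the sum of two orthogonal pieces, of which the first satisfies an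
  evaluation bound with constant \<open>k\<close> and the second is a multiple of one vector of square norm
  \<open>N\<close>.\<close>

lemma sq_add_le_mult_add:
  fixes a b t k q N :: real
  assumes "a\<^sup>2 \<le> k * q" "0 \<le> k" "0 \<le> q" "0 < N"
  shows "(a + t * b)\<^sup>2 \<le> (k + b\<^sup>2 / N) * (q + t\<^sup>2 * N)"
proof -
  define X where "X = k * (t\<^sup>2 * N)"
  define Y where "Y = b\<^sup>2 / N * q"
  have "0 \<le> X" "0 \<le> Y" using assms by (auto simp: X_def Y_def)
  have "(a * (t * b))\<^sup>2 = a\<^sup>2 * (t * b)\<^sup>2" by (simp add: power_mult_distrib)
  also have "\<dots> \<le> k * q * (t * b)\<^sup>2" using assms(1) by (intro mult_right_mono) auto
  also have "\<dots> = X * Y" using assms by (simp add: X_def Y_def power_mult_distrib)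
  finally have "(2 * (a * (t * b)))\<^sup>2 \<le> 4 * (X * Y)" by (simp add: power_mult_distrib)
  also have "\<dots> \<le> (X + Y)\<^sup>2"
    using zero_le_power2[of "X - Y"] by (simp add: power2_eq_square algebra_simps)
  finally have "2 * (a * (t * b)) \<le> X + Y"
    by (rule power2_le_imp_le) (simp add: \<open>0 \<le> X\<close> \<open>0 \<le> Y\<close>)
  moreover have "(k + b\<^sup>2 / N) * (q + t\<^sup>2 * N) = k * q + X + Y + (t * b)\<^sup>2"
    using assms by (simp add: X_def Y_def power_mult_distrib algebra_simps)
  moreover have "(a + t * b)\<^sup>2 = a\<^sup>2 + 2 * (a * (t * b)) + (t * b)\<^sup>2"
    by (simp add: power2_eq_square algebra_simps)
  ultimately show ?thesis using assms(1) by linarith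
qed

text \<open>The dimension bound. If the values on \<open>B\<close> determine the differential of a member of \<open>S\<close>, the
  space of these differentials has dimension at most \<open>|B|\<close>; for an orthonormal basis
  \<open>w 1, ..., w m\<close> of it, \<open>K e = \<Sum>i. (w i e)\<^sup>2\<close> has total \<open>m\<close>. The induction on \<open>B\<close>
  builds this basis: if dropping the point \<open>b\<close> destroys the hypothesis, some \<open>w0\<close> of positive
  energy vanishes on the rest of \<open>B\<close>, and the orthogonal complement of \<open>w0\<close> in \<open>S\<close> satisfies
  the hypothesis without \<open>b\<close>.\<close>

lemma ex_evaluation_bound_with_small_trace:
  fixes S :: "('a \<Rightarrow> real) set"
  assumes "finite B" "finite E"
    and "\<And>u w t. u \<in> S \<Longrightarrow> w \<in> S \<Longrightarrow> (\<lambda>x. u x - t * w x) \<in> S"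
    and "\<And>w. w \<in> S \<Longrightarrow> (\<forall>b\<in>B. w b = 0) \<Longrightarrow> dirichlet_form E w w = 0"
  shows "\<exists>K. (\<forall>e. 0 \<le> K e) \<and> (\<Sum>e\<in>E. K e) \<le> real (card B) \<and>
    (\<forall>w\<in>S. \<forall>e\<in>E. (differential w e)\<^sup>2 \<le> K e * dirichlet_form E w w)"
  using assms(1,3,4)
proof (induction B arbitrary: S)
  case empty
  then show ?case
    using differential_eq_0_if_dirichlet_form_eq_0[OF assms(2)]
    by (intro exI[of _ "\<lambda>_. 0"]) auto
next
  case (insert b B)
  show ?case
  proof (cases "\<forall>w\<in>S. (\<forall>b\<in>B. w b = 0) \<longrightarrow> dirichlet_form E w w = 0")
    case True
    have "\<exists>K. (\<forall>e. 0 \<le> K e) \<and> (\<Sum>e\<in>E. K e) \<le> real (card B) \<and>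
      (\<forall>w\<in>S. \<forall>e\<in>E. (differential w e)\<^sup>2 \<le> K e * dirichlet_form E w w)"
      using insert.prems(1) True by (intro insert.IH) blast+
    moreover have "real (card B) \<le> real (card (insert b B))"
      using insert.hyps by simp
    ultimately show ?thesis by (meson order_trans)
  next
    case False
    then obtain w0 where w0: "w0 \<in> S" "\<And>b. b \<in> B \<Longrightarrow> w0 b = 0" "dirichlet_form E w0 w0 \<noteq> 0" by auto
    define N where "N = dirichlet_form E w0 w0"
    have N: "N > 0" using w0(3) dirichlet_form_self_nonneg[of E w0] by (simp add: N_def)
    have w0b: "w0 b \<noteq> 0" using insert.prems(2)[OF w0(1)] w0 by auto
    define S' where "S' = {w \<in> S. dirichlet_form E w w0 = 0}"
    have "\<exists>K. (\<forall>e. 0 \<le> K e) \<and> (\<Sum>e\<in>E. K e) \<le> real (card B) \<and>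
      (\<forall>w\<in>S'. \<forall>e\<in>E. (differential w e)\<^sup>2 \<le> K e * dirichlet_form E w w)"
    proof (rule insert.IH)
      fix u w t assume uw: "u \<in> S'" "w \<in> S'"
      then have "(\<lambda>x. u x - t * w x) \<in> S" by (intro insert.prems(1)) (simp_all add: S'_def)
      moreover have "dirichlet_form E (\<lambda>x. u x - t * w x) w0 = 0"
        using uw by (simp add: S'_def dirichlet_form_diff_left)
      ultimately show "(\<lambda>x. u x - t * w x) \<in> S'" by (simp add: S'_def)
    next
      fix w assume w: "w \<in> S'" "\<forall>b\<in>B. w b = 0"
      define z where "z = (\<lambda>x. w x - w b / w0 b * w0 x)"
      have "w \<in> S" using w(1) by (simp add: S'_def)
      then have "z \<in> S" unfolding z_def using w0(1) by (rule insert.prems(1))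
      moreover have "\<forall>b'\<in>insert b B. z b' = 0" using w w0 w0b by (auto simp: z_def)
      ultimately have "dirichlet_form E z z = 0" by (rule insert.prems(2))
      then have "dirichlet_form E z w = 0" by (rule dirichlet_form_eq_0_if_self_eq_0[OF assms(2)])
      moreover have "dirichlet_form E z w = dirichlet_form E w w - w b / w0 b * dirichlet_form E w0 w"
        by (simp only: z_def dirichlet_form_diff_left)
      moreover have "dirichlet_form E w0 w = 0"
        using w(1) dirichlet_form_commute[of E w0 w] by (simp add: S'_def)
      ultimately show "dirichlet_form E w w = 0" by simp
    qed
    then obtain K where K: "\<forall>e. 0 \<le> K e" "(\<Sum>e\<in>E. K e) \<le> real (card B)"
      "\<forall>w\<in>S'. \<forall>e\<in>E. (differential w e)\<^sup>2 \<le> K e * dirichlet_form E w w" by blast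
    show ?thesis
    proof (intro exI[of _ "\<lambda>e. K e + (differential w0 e)\<^sup>2 / N"] conjI allI ballI)
      fix e show "0 \<le> K e + (differential w0 e)\<^sup>2 / N" using K(1)[rule_format, of e] N by simp
    next
      have "(\<Sum>e\<in>E. (differential w0 e)\<^sup>2 / N) = 1"
        using N by (simp add: sum_divide_distrib[symmetric] N_def dirichlet_form_self)
      then show "(\<Sum>e\<in>E. K e + (differential w0 e)\<^sup>2 / N) \<le> real (card (insert b B))"
        using K(2) insert.hyps by (simp add: sum.distrib)
    next
      fix w e assume w: "w \<in> S" and e: "e \<in> E"
      define t where "t = dirichlet_form E w w0 / N"
      define w' where "w' = (\<lambda>x. w x - t * w0 x)"
      have orth: "dirichlet_form E w' w0 = 0"
        unfolding w'_def dirichlet_form_diff_left N_def[symmetric] using N by (simp add: t_def)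
      have "w' \<in> S" unfolding w'_def using w w0(1) by (rule insert.prems(1))
      then have w': "w' \<in> S'" using orth by (simp add: S'_def)
      have w_eq: "w = (\<lambda>x. w' x - (- t) * w0 x)" by (simp add: w'_def)
      have "dirichlet_form E w w = dirichlet_form E w' w' + t\<^sup>2 * N"
      proof -
        have "dirichlet_form E w0 w' = 0" using orth dirichlet_form_commute[of E w0 w'] by simp
        moreover have "dirichlet_form E w w = dirichlet_form E w' w' - (- t) * dirichlet_form E w' w0
            - (- t) * (dirichlet_form E w0 w' - (- t) * dirichlet_form E w0 w0)"
          by (subst (1 2) w_eq) (simp only: dirichlet_form_diff_left dirichlet_form_diff_right)
        ultimately show ?thesis by (simp add: orth N_def power2_eq_square)
      qed
      moreover have "differential w e = differential w' e + t * differential w0 e"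
        using differential_diff[of w' "- t" w0 e] unfolding w_eq[symmetric] by simp
      moreover have "(differential w' e + t * differential w0 e)\<^sup>2 \<le>
          (K e + (differential w0 e)\<^sup>2 / N) * (dirichlet_form E w' w' + t\<^sup>2 * N)"
        using bspec[OF bspec[OF K(3) w'] e] K(1)[rule_format, of e] dirichlet_form_self_nonneg N
        by (rule sq_add_le_mult_add)
      ultimately show "(differential w e)\<^sup>2 \<le> (K e + (differential w0 e)\<^sup>2 / N) * dirichlet_form E w w"
        by simp
    qed
  qed
qed

section \<open>Coarse maps and the uniform lower bound for local energy\<close>

context bounded_valency_relation
begin

text \<open>What is needed of a quasi-isomorphism for pulling back energies: neighbours stay close, and
  fibres are contained in balls, hence of bounded size.\<close>

definition coarse_map :: "nat \<Rightarrow> ('a \<Rightarrow> 'a) \<Rightarrow> bool" where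
  "coarse_map L f \<longleftrightarrow> (\<forall>(x, y) \<in> A. f y \<in> nball L (f x)) \<and>
    (\<forall>x \<in> Domain A. \<forall>y \<in> Domain A. f x = f y \<longrightarrow> y \<in> nball L x)"

definition pullback_const :: "nat \<Rightarrow> real" where
  "pullback_const L = chain_const L (d * (d + 1) ^ L)"

lemma coarse_map_fibre:
  assumes "coarse_map L f"
  shows "finite {x \<in> Domain A. f x = z}" and "card {x \<in> Domain A. f x = z} \<le> (d + 1) ^ L"
proof -
  have "finite {x \<in> Domain A. f x = z} \<and> card {x \<in> Domain A. f x = z} \<le> (d + 1) ^ L"
  proof (cases "{x \<in> Domain A. f x = z} = {}")
    case True
    show ?thesis unfolding True by simp
  next
    case False
    then obtain x0 where "x0 \<in> Domain A" "f x0 = z" by blast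
    then have "{x \<in> Domain A. f x = z} \<subseteq> nball L x0"
      using assms unfolding coarse_map_def by blast
    then show ?thesis
      using finite_nball[of L x0] card_nball[of L x0]
      by (meson card_mono finite_subset order_trans)
  qed
  then show "finite {x \<in> Domain A. f x = z}" "card {x \<in> Domain A. f x = z} \<le> (d + 1) ^ L"
    by auto
qed

lemma coarse_map_arc_fibre:
  assumes "coarse_map L f"
  shows "finite {e \<in> A. f (fst e) = z} \<and> card {e \<in> A. f (fst e) = z} \<le> d * (d + 1) ^ L"
proof -
  let ?D = "{x \<in> Domain A. f x = z}"
  have eq: "{e \<in> A. f (fst e) = z} = (\<Union>x\<in>?D. {e \<in> A. fst e = x})" by auto
  have "card (\<Union>x\<in>?D. {e \<in> A. fst e = x}) \<le> (\<Sum>x\<in>?D. card {e \<in> A. fst e = x})"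
    by (intro card_UN_le coarse_map_fibre[OF assms])
  also have "\<dots> \<le> (\<Sum>x\<in>?D. d)"
    by (intro sum_mono card_arcs_from)
  also have "\<dots> \<le> d * (d + 1) ^ L"
    using coarse_map_fibre(2)[OF assms, of z] by simp
  finally show ?thesis
    unfolding eq using coarse_map_fibre(1)[OF assms, of z] card_arcs_from(2) by blast
qed

lemma pullback_const_nonneg: "0 \<le> pullback_const L"
  by (simp add: pullback_const_def chain_const_nonneg)

lemma differential_comp: "differential (\<lambda>x. u (f x)) e = u (f (snd e)) - u (f (fst e))"
  by (cases e) simp

lemma coarse_map_arc: "coarse_map L f \<Longrightarrow> e \<in> A \<Longrightarrow> f (snd e) \<in> nball L (f (fst e))"
  by (auto simp: coarse_map_def)

lemma coarse_pullback_energy: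
  assumes f: "coarse_map L f" and fin: "finite_energy u"
  shows "finite_energy (\<lambda>x. u (f x))"
    and "energy (\<lambda>x. u (f x)) \<le> pullback_const L * energy u"
  using infsum_sq_diff_le_energy[where I = A and a = "\<lambda>e. f (fst e)" and b = "\<lambda>e. f (snd e)",
      OF fin coarse_map_arc[OF f] coarse_map_arc_fibre[OF f]]
  by (simp_all add: finite_energy_def energy_def pullback_const_def differential_comp)

lemma coarse_pullback_local_energy:
  assumes f: "coarse_map L f" and X: "finite X" "X \<subseteq> A"
  shows "(\<Sum>e\<in>X. (differential (\<lambda>x. u (f x)) e)\<^sup>2) \<le>
    pullback_const L * (\<Sum>e \<in> (\<Union>e\<in>X. arcs_near L (f (fst e))). (differential u e)\<^sup>2)"
proof -
  have "card {e \<in> X. f (fst e) = z} \<le> d * (d + 1) ^ L" for z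
  proof -
    have "card {e \<in> X. f (fst e) = z} \<le> card {e \<in> A. f (fst e) = z}"
      using X coarse_map_arc_fibre[OF f] by (intro card_mono) auto
    then show ?thesis using coarse_map_arc_fibre[OF f, of z] by simp
  qed
  then show ?thesis
    using sum_sq_diff_le_energy_near[where I = X and a = "\<lambda>e. f (fst e)" and b = "\<lambda>e. f (snd e)"
        and u = u and n = L and M = "d * (d + 1) ^ L"] X coarse_map_arc[OF f]
    by (auto simp: differential_comp pullback_const_def)
qed

text \<open>With \<open>w = v \<circ> f - g\<close> this says that \<open>v - w \<circ> h\<close> is square summable, so that
  \<open>Green_harmonic\<close> applies to it.\<close>

lemma diff_round_trip_summable:
  assumes fin: "finite_energy v"
    and h: "coarse_map L h"
    and fh: "\<And>y. y \<in> Domain A \<Longrightarrow> f (h y) \<in> nball L y"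
    and g: "finite {x. g x \<noteq> 0}"
  shows "(\<lambda>y. (v y - (v (f (h y)) - g (h y)))\<^sup>2) summable_on Domain A"
proof (rule summable_on_comparison_test)
  have "(\<lambda>y. (v (f (h y)) - v y)\<^sup>2) summable_on Domain A"
  proof (rule infsum_sq_diff_le_energy(1)[OF fin fh])
    fix z
    have "{y \<in> Domain A. y = z} \<subseteq> {z}" by blast
    then show "finite {y \<in> Domain A. y = z} \<and> card {y \<in> Domain A. y = z} \<le> 1"
      using card_mono[of "{z}" "{y \<in> Domain A. y = z}"] finite_subset by auto
  qed
  moreover have "(\<lambda>y. (g (h y))\<^sup>2) summable_on Domain A"
  proof -
    let ?Y = "\<Union>z \<in> {x. g x \<noteq> 0}. {y \<in> Domain A. h y = z}"
    have "finite ?Y" using g coarse_map_fibre(1)[OF h] by blast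
    then have "(\<lambda>y. (g (h y))\<^sup>2) summable_on ?Y" by simp
    then show ?thesis
      by (subst summable_on_cong_neutral[where S = "Domain A" and T = ?Y]) auto
  qed
  ultimately show "(\<lambda>y. 2 * (v (f (h y)) - v y)\<^sup>2 + 2 * (g (h y))\<^sup>2) summable_on Domain A"
    by (intro summable_on_add summable_on_cmult_right)
  fix y
  have "(s - (t - r))\<^sup>2 \<le> 2 * (t - s)\<^sup>2 + 2 * r\<^sup>2" for r s t :: real
    using zero_le_power2[of "s - t - r"] by (simp add: power2_eq_square algebra_simps)
  then show "(v y - (v (f (h y)) - g (h y)))\<^sup>2 \<le> 2 * (v (f (h y)) - v y)\<^sup>2 + 2 * (g (h y))\<^sup>2" .
qed simp

text \<open>The lower estimate. The point is the order of quantifiers: \<open>R\<close> and \<open>c\<close>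
  depend on \<open>v\<close>, \<open>L\<close> and \<open>r\<close>, but not on \<open>f\<close>, \<open>h\<close>, \<open>g\<close> or \<open>x\<close>. The function \<open>r\<close>
  expresses that \<open>h\<close> maps points near \<open>x0\<close> to points near \<open>x\<close>.

  With \<open>E\<close> the energy of \<open>v\<close>, \<open>W = w \<circ> h\<close> and \<open>C\<close> the constant for pulling back, the energy of
  \<open>W\<close> is at most \<open>C\<^sup>2 E\<close>. A finite set \<open>A0\<close> of arcs is chosen that carries all but
  \<open>E / (4 s)\<close> of the energy of \<open>v\<close>, and \<open>dv dW\<close> is estimated by Young's inequality with
  weight \<open>1\<close> on \<open>A0\<close> and weight \<open>s = 2 C\<^sup>2\<close> off \<open>A0\<close>. This yields
  \<open>E \<le> E / 2 + E / 4 + X / 2 + E / 8\<close> with \<open>X\<close> the energy of \<open>W\<close> on \<open>A0\<close>.\<close>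

lemma uniform_local_energy:
  assumes fin: "finite_energy v"
    and harm: "\<And>x. (\<Sum>y \<in> A `` {x}. v y - v x) = 0"
    and pos: "energy v > 0"
    and conn: "\<And>y. y \<in> Domain A \<Longrightarrow> \<exists>n. y \<in> nball n x0"
  obtains R c where "c > 0"
    and "\<And>f h g x. coarse_map L f \<Longrightarrow> coarse_map L h \<Longrightarrow>
      (\<And>y. y \<in> Domain A \<Longrightarrow> f (h y) \<in> nball L y) \<Longrightarrow>
      (\<And>y n. y \<in> Domain A \<Longrightarrow> y \<in> nball n x0 \<Longrightarrow> h y \<in> nball (r n) x) \<Longrightarrow>
      finite {x. g x \<noteq> 0} \<Longrightarrow>
      finite_energy (\<lambda>y. v (f y) - g y) \<Longrightarrow>
      energy (\<lambda>y. v (f y) - g y) \<le> energy (\<lambda>y. v (f y)) \<Longrightarrow>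
      c \<le> (\<Sum>e\<in>arcs_near R x. (differential (\<lambda>y. v (f y) - g y) e)\<^sup>2)"
proof -
  define E where "E = energy v"
  define C where "C = pullback_const L + 1"
  have C: "C > 0" using pullback_const_nonneg[of L] by (simp add: C_def)
  define s where "s = 2 * C\<^sup>2"
  have s: "s > 0" using C by (simp add: s_def)
  have E: "E > 0" using pos by (simp add: E_def)
  have v_sum: "((\<lambda>e. (differential v e)\<^sup>2) has_sum E) A"
    using fin by (simp add: E_def energy_def finite_energy_def)
  obtain A0 where A0: "finite A0" "A0 \<subseteq> A"
    and approx: "dist (\<Sum>e\<in>A0. (differential v e)\<^sup>2) E \<le> E / (4 * s)"
    using has_sum_finite_approximation[OF v_sum, of "E / (4 * s)"] E s by auto
  define T where "T = E - (\<Sum>e\<in>A0. (differential v e)\<^sup>2)"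
  have T: "T \<le> E / (4 * s)" using approx by (simp add: T_def dist_real_def)
  have tail: "((\<lambda>e. (differential v e)\<^sup>2) has_sum T) (A - A0)"
    unfolding T_def using A0 by (intro has_sum_Diff v_sum has_sum_finite) auto
  have "\<exists>n. \<forall>e\<in>A0. fst e \<in> nball n x0"
    using A0
  proof (induction A0 rule: finite_induct)
    case (insert e A0)
    then obtain m where m: "\<forall>e\<in>A0. fst e \<in> nball m x0" by auto
    have "fst e \<in> Domain A" using insert.prems by (auto simp: Domain_fst)
    then obtain k where k: "fst e \<in> nball k x0" using conn by blast
    have "\<forall>e\<in>insert e A0. fst e \<in> nball (max m k) x0"
      using m k nball_mono[of m "max m k" x0] nball_mono[of k "max m k" x0] by auto
    then show ?case by blast
  qed auto
  then obtain n where n: "\<And>e. e \<in> A0 \<Longrightarrow> fst e \<in> nball n x0" by blast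
  show thesis
  proof (rule that[of "E / (4 * C)" "r n + L"])
    show "E / (4 * C) > 0" using E C by simp
    fix f h g x
    assume f: "coarse_map L f" and h: "coarse_map L h"
      and fh: "\<And>y. y \<in> Domain A \<Longrightarrow> f (h y) \<in> nball L y"
      and hx: "\<And>y n. y \<in> Domain A \<Longrightarrow> y \<in> nball n x0 \<Longrightarrow> h y \<in> nball (r n) x"
      and g: "finite {x. g x \<noteq> (0::real)}"
      and w_fin: "finite_energy (\<lambda>y. v (f y) - g y)"
      and w_le: "energy (\<lambda>y. v (f y) - g y) \<le> energy (\<lambda>y. v (f y))"
    define w where "w = (\<lambda>y. v (f y) - g y)"
    define W where "W = (\<lambda>y. w (h y))"
    define X where "X = (\<Sum>e\<in>A0. (differential W e)\<^sup>2)"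
    have pull: "pullback_const L * t \<le> C * t" if "0 \<le> t" for t
      using that by (simp add: C_def mult_right_mono)
    have W_fin: "finite_energy W"
      unfolding W_def by (rule coarse_pullback_energy[OF h]) (simp add: w_def w_fin)
    have "energy W \<le> C * energy w"
      using coarse_pullback_energy(2)[OF h, of w] w_fin pull[OF energy_nonneg, of w]
      by (simp add: W_def w_def)
    also have "energy w \<le> C * E"
      using w_le coarse_pullback_energy(2)[OF f fin] pull[OF energy_nonneg, of v]
      by (simp add: w_def E_def)
    finally have W_le: "energy W \<le> C\<^sup>2 * E"
      using C by (simp add: power2_eq_square mult.assoc)
    have W_sum: "((\<lambda>e. (differential W e)\<^sup>2) has_sum energy W) A"
      using W_fin by (simp add: energy_def finite_energy_def)

    define \<psi> where "\<psi> = (\<lambda>y. v y - W y)"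
    have "(\<lambda>y. (\<psi> y)\<^sup>2) summable_on Domain A"
      using diff_round_trip_summable[OF fin h fh g] by (simp add: \<psi>_def W_def w_def)
    from Green_harmonic[OF fin harm this]
    have orth: "((\<lambda>e. differential v e * differential \<psi> e) has_sum 0) A"
      by (simp add: has_sum_iff)
    have d\<psi>: "differential \<psi> e = differential v e - differential W e" for e
      using differential_diff[of v 1 W e] by (simp add: \<psi>_def)

    let ?near = "\<lambda>e. if e \<in> A0 then (differential W e)\<^sup>2 / 2 else 0"
    let ?far = "\<lambda>e. if e \<in> A - A0 then s / 2 * (differential v e)\<^sup>2 else 0"
    have near: "(?near has_sum X / 2) A"
    proof -
      have "((\<lambda>e. (differential W e)\<^sup>2 / 2) has_sum X / 2) A0"
        using A0(1) by (intro has_sum_finiteI) (simp_all add: X_def sum_divide_distrib)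
      then show ?thesis
        by (subst has_sum_cong_neutral[where T = A0]) (use A0 in auto)
    qed
    have far: "(?far has_sum s / 2 * T) A"
      by (subst has_sum_cong_neutral[where T = "A - A0"])
        (use has_sum_cmult_right[OF tail, of "s / 2"] in auto)
    have dom: "((\<lambda>e. differential v e * differential \<psi> e + 1 / 2 * (differential v e)\<^sup>2
        + 1 / (2 * s) * (differential W e)\<^sup>2 + ?near e + ?far e) has_sum
        (0 + 1 / 2 * E + 1 / (2 * s) * energy W + X / 2 + s / 2 * T)) A"
      by (intro has_sum_add has_sum_cmult_right orth v_sum W_sum near far)
    have "E \<le> 0 + 1 / 2 * E + 1 / (2 * s) * energy W + X / 2 + s / 2 * T"
    proof (rule has_sum_mono[OF v_sum dom])
      fix e assume "e \<in> A"
      have young1: "p * q \<le> 1 / 2 * p\<^sup>2 + q\<^sup>2 / 2" for p q :: real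
        using zero_le_power2[of "p - q"] by (simp add: power2_eq_square algebra_simps)
      have young2: "p * q \<le> s / 2 * p\<^sup>2 + 1 / (2 * s) * q\<^sup>2" for p q :: real
      proof -
        have "0 \<le> (s * p - q)\<^sup>2 / (2 * s)" using s by simp
        also have "\<dots> = s / 2 * p\<^sup>2 + 1 / (2 * s) * q\<^sup>2 - p * q"
          using s by (simp add: power2_eq_square field_simps)
        finally show ?thesis by simp
      qed
      have "differential v e * differential W e \<le>
          1 / 2 * (differential v e)\<^sup>2 + 1 / (2 * s) * (differential W e)\<^sup>2 + ?near e + ?far e"
      proof (cases "e \<in> A0")
        case True
        have "0 \<le> 1 / (2 * s) * (differential W e)\<^sup>2" using s by simp
        with True show ?thesis
          using young1[of "differential v e" "differential W e"] by simp
      next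
        case False
        then have "?near e = 0" "?far e = s / 2 * (differential v e)\<^sup>2"
          using \<open>e \<in> A\<close> by simp_all
        moreover have "0 \<le> 1 / 2 * (differential v e)\<^sup>2" by simp
        ultimately show ?thesis
          using young2[of "differential v e" "differential W e"] by linarith
      qed
      then show "(differential v e)\<^sup>2 \<le> differential v e * differential \<psi> e
          + 1 / 2 * (differential v e)\<^sup>2 + 1 / (2 * s) * (differential W e)\<^sup>2 + ?near e + ?far e"
        unfolding d\<psi> by (simp add: power2_eq_square algebra_simps)
    qed
    moreover have "1 / (2 * s) * energy W \<le> E / 4"
    proof -
      have "1 / (2 * s) * energy W \<le> 1 / (2 * s) * (C\<^sup>2 * E)"
        using W_le s by (intro mult_left_mono) auto
      also have "\<dots> = E / 4" using C by (simp add: s_def)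
      finally show ?thesis .
    qed
    moreover have "s / 2 * T \<le> E / 8"
    proof -
      have "s / 2 * T \<le> s / 2 * (E / (4 * s))"
        using T s by (intro mult_left_mono) auto
      also have "\<dots> = E / 8" using s by simp
      finally show ?thesis .
    qed
    ultimately have X_ge: "E / 4 \<le> X" using E by linarith
    let ?N = "\<Union>e\<in>A0. arcs_near L (h (fst e))"
    have "X \<le> pullback_const L * (\<Sum>e\<in>?N. (differential w e)\<^sup>2)"
      unfolding X_def W_def by (rule coarse_pullback_local_energy[OF h A0])
    also have "\<dots> \<le> C * (\<Sum>e\<in>?N. (differential w e)\<^sup>2)"
      by (intro pull sum_nonneg) simp
    also have "(\<Sum>e\<in>?N. (differential w e)\<^sup>2) \<le> (\<Sum>e\<in>arcs_near (r n + L) x. (differential w e)\<^sup>2)"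
    proof (intro sum_mono2 finite_arcs_near UN_least)
      fix e assume "e \<in> A0"
      then have "h (fst e) \<in> nball (r n) x"
        using A0(2) by (intro hx n) (auto simp: Domain_fst)
      then show "arcs_near L (h (fst e)) \<subseteq> arcs_near (r n + L) x"
        by (rule arcs_near_trans)
    qed simp
    finally have "E / 4 \<le> C * (\<Sum>e\<in>arcs_near (r n + L) x. (differential w e)\<^sup>2)"
      using X_ge C by simp
    then show "E / (4 * C) \<le>
        (\<Sum>e\<in>arcs_near (r n + L) x. (differential (\<lambda>y. v (f y) - g y) e)\<^sup>2)"
      using C by (simp add: w_def field_simps)
  qed
qed

section \<open>Harmonic functions inside a finite set and the isoperimetric inequality\<close>

definition inner_boundary :: "'a set \<Rightarrow> 'a set" where
  "inner_boundary F = {x \<in> F. \<exists>y. (x, y) \<in> A \<and> y \<notin> F}"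

lemma inner_boundary_within:
  assumes "x \<in> F" "y \<in> nball n x" "y \<notin> F"
  shows "\<exists>b \<in> inner_boundary F. x \<in> nball n b"
proof -
  have "\<exists>b \<in> inner_boundary F. b \<in> nball n x"
    using assms(2,3)
  proof (induction n arbitrary: y)
    case 0
    then show ?case using assms(1) by simp
  next
    case (Suc n)
    then obtain z where z: "z \<in> nball n x" "y = z \<or> (z, y) \<in> A" by (auto simp: nball_Suc)
    show ?case
    proof (cases "z \<in> F")
      case True
      then have "z \<in> inner_boundary F" using z Suc.prems by (auto simp: inner_boundary_def)
      then show ?thesis using z nball_mono[of n "Suc n" x] by auto
    next
      case False
      then show ?thesis using Suc.IH[of z] z nball_mono[of n "Suc n" x] by auto
    qed
  qed
  then show ?thesis using nball_sym by blast
qed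

lemma card_near_boundary:
  assumes "finite F"
  shows "card {x \<in> F. \<not> nball n x \<subseteq> F} \<le> card (inner_boundary F) * (d + 1) ^ n"
proof -
  have fin: "finite (inner_boundary F)" using assms by (simp add: inner_boundary_def)
  have "{x \<in> F. \<not> nball n x \<subseteq> F} \<subseteq> (\<Union>b \<in> inner_boundary F. nball n b)"
    using inner_boundary_within by blast
  then have "card {x \<in> F. \<not> nball n x \<subseteq> F} \<le> card (\<Union>b \<in> inner_boundary F. nball n b)"
    using fin finite_nball by (intro card_mono) auto
  also have "\<dots> \<le> (\<Sum>b \<in> inner_boundary F. card (nball n b))"
    by (intro card_UN_le fin)
  also have "\<dots> \<le> (\<Sum>b \<in> inner_boundary F. (d + 1) ^ n)"
    by (intro sum_mono card_nball)
  finally show ?thesis by simp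
qed

definition arcs_in :: "'a set \<Rightarrow> ('a \<times> 'a) set" where
  "arcs_in F = A \<inter> F \<times> F"

lemma finite_arcs_in: "finite F \<Longrightarrow> finite (arcs_in F)"
  by (simp add: arcs_in_def)

lemma arcs_near_subset_arcs_in:
  assumes "nball (Suc n) x \<subseteq> F"
  shows "arcs_near n x \<subseteq> arcs_in F"
proof
  fix e assume e: "e \<in> arcs_near n x"
  then have "fst e \<in> nball (Suc n) x" "snd e \<in> nball (Suc n) x"
    by (cases e; auto simp: arcs_near_def nball_Suc)+
  then show "e \<in> arcs_in F"
    using e assms by (cases e) (auto simp: arcs_in_def arcs_near_def)
qed

lemma differential_eq_0_off_arcs_in:
  assumes "\<And>x. x \<notin> F - inner_boundary F \<Longrightarrow> g x = 0" "e \<in> A - arcs_in F"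
  shows "differential g e = 0"
proof -
  obtain x y where e: "e = (x, y)" by (cases e)
  have "(x, y) \<in> A" "(y, x) \<in> A" using assms(2) sym_A by (auto simp: e sym_def)
  then have "x \<notin> F - inner_boundary F" "y \<notin> F - inner_boundary F"
    using assms(2) by (auto simp: e arcs_in_def inner_boundary_def)
  then show ?thesis using assms(1)[of x] assms(1)[of y] by (simp add: e)
qed

text \<open>Harmonicity in weak form; it is closed under linear combinations and a function that is
  harmonic in this sense and vanishes on the boundary can be tested against itself.\<close>

definition harmonic_inside :: "'a set \<Rightarrow> ('a \<Rightarrow> real) \<Rightarrow> bool" where
  "harmonic_inside F w \<longleftrightarrow>
    (\<forall>g. (\<forall>x. x \<notin> F - inner_boundary F \<longrightarrow> g x = 0) \<longrightarrow> dirichlet_form (arcs_in F) w g = 0)"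

text \<open>Dirichlet's principle: the energy of \<open>u\<close> inside \<open>F\<close> is the sum of those of \<open>u - g\<close> and
  \<open>g\<close>, and outside nothing changes.\<close>

lemma ex_harmonic_inside_replacement:
  assumes "finite F" and fin: "finite_energy u"
  obtains g where "finite {x. g x \<noteq> 0}" "harmonic_inside F (\<lambda>x. u x - g x)"
    "finite_energy (\<lambda>x. u x - g x)" "energy (\<lambda>x. u x - g x) \<le> energy u"
proof -
  let ?E = "arcs_in F"
  obtain g where g: "\<And>x. x \<notin> F - inner_boundary F \<Longrightarrow> g x = 0"
    and orth: "\<And>g'. (\<forall>x. x \<notin> F - inner_boundary F \<longrightarrow> g' x = 0) \<Longrightarrow> dirichlet_form ?E (\<lambda>x. u x - g x) g' = 0"
    using ex_finitely_supported_projection[of "F - inner_boundary F" ?E u] assms(1) finite_arcs_in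
    by auto
  define w where "w = (\<lambda>x. u x - g x)"
  have E: "finite ?E" "?E \<subseteq> A" using assms(1) finite_arcs_in by (auto simp: arcs_in_def)
  have split: "A = ?E \<union> (A - ?E)" using E by blast
  have wu: "differential w e = differential u e" if "e \<in> A - ?E" for e
    using differential_diff[of u 1 g e] differential_eq_0_off_arcs_in[of F g e] g that
    by (simp add: w_def)
  have u_out: "(\<lambda>e. (differential u e)\<^sup>2) summable_on (A - ?E)"
    using fin E by (auto simp: finite_energy_def intro: summable_on_cofin_subset)
  then have w_out: "(\<lambda>e. (differential w e)\<^sup>2) summable_on (A - ?E)"
    by (subst summable_on_cong[where g = "\<lambda>e. (differential u e)\<^sup>2"]) (simp_all add: wu)
  have "(\<lambda>e. (differential w e)\<^sup>2) summable_on A"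
    by (subst split, rule summable_on_Un_disjoint) (use E w_out in auto)
  then have w_fin: "finite_energy w" by (simp add: finite_energy_def)
  have decomp: "energy z = dirichlet_form ?E z z + (\<Sum>\<^sub>\<infinity>e\<in>A - ?E. (differential z e)\<^sup>2)"
    if "(\<lambda>e. (differential z e)\<^sup>2) summable_on (A - ?E)" for z
    unfolding energy_def dirichlet_form_self
    by (subst split, subst infsum_Un_disjoint) (use E that in auto)
  have "dirichlet_form ?E u u = dirichlet_form ?E w w + dirichlet_form ?E g g"
  proof -
    have wg: "dirichlet_form ?E w g = 0" using orth[of g] g by (simp add: w_def)
    have u: "u = (\<lambda>x. w x - (-1) * g x)" by (simp add: w_def)
    have "dirichlet_form ?E u u = dirichlet_form ?E w w - (-1) * dirichlet_form ?E w g
        - (-1) * (dirichlet_form ?E g w - (-1) * dirichlet_form ?E g g)"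
      by (subst (1 2) u) (simp only: dirichlet_form_diff_left dirichlet_form_diff_right)
    then show ?thesis using wg dirichlet_form_commute[of ?E g w] by simp
  qed
  then have "dirichlet_form ?E w w \<le> dirichlet_form ?E u u" using dirichlet_form_self_nonneg[of ?E g] by simp
  moreover have "(\<Sum>\<^sub>\<infinity>e\<in>A - ?E. (differential w e)\<^sup>2) = (\<Sum>\<^sub>\<infinity>e\<in>A - ?E. (differential u e)\<^sup>2)"
    by (intro infsum_cong) (simp add: wu)
  ultimately have "energy w \<le> energy u"
    using decomp[OF u_out] decomp[OF w_out] by simp
  moreover have "finite {x. g x \<noteq> 0}"
    by (rule finite_subset[of _ F]) (use g assms(1) in auto)
  ultimately show thesis
    using that[of g] orth w_fin by (simp add: w_def harmonic_inside_def)
qed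

text \<open>The upper estimate: a function that is harmonic inside \<open>F\<close> and zero on the inner boundary
  agrees on \<open>F\<close> with an admissible test function, hence has zero energy there.\<close>

lemma ex_harmonic_inside_evaluation_bound:
  assumes "finite F"
  obtains K where "\<And>e. 0 \<le> K e" "(\<Sum>e\<in>arcs_in F. K e) \<le> real (card (inner_boundary F))"
    "\<And>w e. harmonic_inside F w \<Longrightarrow> e \<in> arcs_in F \<Longrightarrow>
      (differential w e)\<^sup>2 \<le> K e * dirichlet_form (arcs_in F) w w"
proof -
  let ?S = "{w. harmonic_inside F w}"
  have "\<exists>K. (\<forall>e. 0 \<le> K e) \<and> (\<Sum>e\<in>arcs_in F. K e) \<le> real (card (inner_boundary F)) \<and>
    (\<forall>w\<in>?S. \<forall>e\<in>arcs_in F. (differential w e)\<^sup>2 \<le> K e * dirichlet_form (arcs_in F) w w)"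
  proof (rule ex_evaluation_bound_with_small_trace)
    show "finite (inner_boundary F)" using assms by (simp add: inner_boundary_def)
    show "finite (arcs_in F)" using assms by (rule finite_arcs_in)
    fix u w t assume "u \<in> ?S" "w \<in> ?S"
    then show "(\<lambda>x. u x - t * w x) \<in> ?S" by (simp add: harmonic_inside_def dirichlet_form_diff_left)
  next
    fix w assume w: "w \<in> ?S" "\<forall>b\<in>inner_boundary F. w b = 0"
    define w' where "w' x = (if x \<in> F - inner_boundary F then w x else 0)" for x
    have "dirichlet_form (arcs_in F) w w' = 0" using w(1) by (simp add: harmonic_inside_def w'_def)
    moreover have "differential w e = differential w' e" if "e \<in> arcs_in F" for e
      using that w(2) by (cases e) (auto simp: arcs_in_def w'_def)
    ultimately show "dirichlet_form (arcs_in F) w w = 0" using dirichlet_form_cong[of "arcs_in F" w w' w] by simp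
  qed
  then show thesis using that by blast
qed

text \<open>The two estimates are combined on the set \<open>F'\<close> of those \<open>x\<close> whose neighbourhood of radius
  \<open>R + 1\<close> lies in \<open>F\<close>, so that all arcs near \<open>x\<close> are arcs inside \<open>F\<close> and covered by \<open>K\<close>. For
  each of them \<open>c\<close> is at most \<open>Q\<close> times the sum of \<open>K\<close> over the arcs near \<open>x\<close>, where \<open>Q\<close> bounds
  the energies of all the harmonic replacements, and each arc is near boundedly many \<open>x\<close>.\<close>

lemma strong_isoperimetric_inequality:
  assumes fin: "finite_energy v"
    and harm: "\<And>x. (\<Sum>y \<in> A `` {x}. v y - v x) = 0"
    and pos: "energy v > 0"
    and conn: "\<And>y. y \<in> Domain A \<Longrightarrow> \<exists>n. y \<in> nball n x0"
    and homogeneous: "\<And>x. x \<in> V \<Longrightarrow> \<exists>f h. coarse_map L f \<and> coarse_map L h \<and>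
      (\<forall>y \<in> Domain A. f (h y) \<in> nball L y) \<and>
      (\<forall>y \<in> Domain A. \<forall>n. y \<in> nball n x0 \<longrightarrow> h y \<in> nball (r n) x)"
  obtains C :: real where "C > 0"
    and "\<And>F. finite F \<Longrightarrow> F \<subseteq> V \<Longrightarrow> real (card F) \<le> C * real (card (inner_boundary F))"
proof (rule uniform_local_energy[OF fin harm pos conn, where L = L and r = r])
  fix R c
  assume c: "c > (0::real)" and
    local: "\<And>f h g x. coarse_map L f \<Longrightarrow> coarse_map L h \<Longrightarrow>
      (\<And>y. y \<in> Domain A \<Longrightarrow> f (h y) \<in> nball L y) \<Longrightarrow>
      (\<And>y n. y \<in> Domain A \<Longrightarrow> y \<in> nball n x0 \<Longrightarrow> h y \<in> nball (r n) x) \<Longrightarrow>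
      finite {x. g x \<noteq> 0} \<Longrightarrow>
      finite_energy (\<lambda>y. v (f y) - g y) \<Longrightarrow>
      energy (\<lambda>y. v (f y) - g y) \<le> energy (\<lambda>y. v (f y)) \<Longrightarrow>
      c \<le> (\<Sum>e\<in>arcs_near R x. (differential (\<lambda>y. v (f y) - g y) e)\<^sup>2)"
  define Q where "Q = pullback_const L * energy v"
  have Q: "Q \<ge> 0" by (simp add: Q_def pullback_const_nonneg energy_nonneg)
  define C where "C = real ((d + 1) ^ Suc R) + Q * real ((d + 1) ^ R) / c"
  show thesis
  proof (rule that[of C])
    show "C > 0" using Q c by (auto simp: C_def intro!: add_pos_nonneg)
    fix F assume F: "finite F" "F \<subseteq> V"
    let ?B = "inner_boundary F" and ?E = "arcs_in F"
    define F' where "F' = {x \<in> F. nball (Suc R) x \<subseteq> F}"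
    have F': "finite F'" using F by (simp add: F'_def)
    obtain K where K: "\<And>e. 0 \<le> K e" "(\<Sum>e\<in>?E. K e) \<le> real (card ?B)"
      "\<And>w e. harmonic_inside F w \<Longrightarrow> e \<in> ?E \<Longrightarrow> (differential w e)\<^sup>2 \<le> K e * dirichlet_form ?E w w"
      using ex_harmonic_inside_evaluation_bound[OF F(1)] by blast
    have sub: "arcs_near R x \<subseteq> ?E" if "x \<in> F'" for x
      using arcs_near_subset_arcs_in that by (simp add: F'_def)
    have deep: "c \<le> Q * (\<Sum>e\<in>arcs_near R x. K e)" if x: "x \<in> F'" for x
    proof -
      have "x \<in> V" using x F by (auto simp: F'_def)
      then obtain f h where f: "coarse_map L f" and h: "coarse_map L h"
        "\<And>y. y \<in> Domain A \<Longrightarrow> f (h y) \<in> nball L y"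
        "\<And>y n. y \<in> Domain A \<Longrightarrow> y \<in> nball n x0 \<Longrightarrow> h y \<in> nball (r n) x"
        using homogeneous by meson
      obtain g where g: "finite {y. g y \<noteq> 0}" "harmonic_inside F (\<lambda>y. v (f y) - g y)"
        "finite_energy (\<lambda>y. v (f y) - g y)"
        "energy (\<lambda>y. v (f y) - g y) \<le> energy (\<lambda>y. v (f y))"
        using ex_harmonic_inside_replacement[OF F(1) coarse_pullback_energy(1)[OF f fin]] by blast
      define w where "w = (\<lambda>y. v (f y) - g y)"
      have "dirichlet_form ?E w w \<le> energy w"
        unfolding dirichlet_form_self using g(3) F finite_arcs_in
        by (intro sum_sq_le_energy) (auto simp: w_def arcs_in_def)
      also have "\<dots> \<le> Q"
        using g(4) coarse_pullback_energy(2)[OF f fin] by (simp add: w_def Q_def)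
      finally have "dirichlet_form ?E w w \<le> Q" .
      have "c \<le> (\<Sum>e\<in>arcs_near R x. (differential w e)\<^sup>2)"
        unfolding w_def by (rule local[OF f h g(1,3,4)])
      also have "\<dots> \<le> (\<Sum>e\<in>arcs_near R x. K e * Q)"
      proof (rule sum_mono)
        fix e assume "e \<in> arcs_near R x"
        then have "(differential w e)\<^sup>2 \<le> K e * dirichlet_form ?E w w"
          using g(2) sub[OF x] by (intro K(3)) (auto simp: w_def)
        also have "\<dots> \<le> K e * Q"
          using K(1)[of e] \<open>dirichlet_form ?E w w \<le> Q\<close> by (rule mult_left_mono[rotated])
        finally show "(differential w e)\<^sup>2 \<le> K e * Q" .
      qed
      finally show ?thesis by (simp add: sum_distrib_left mult.commute)
    qed
    have "real (card F') * c \<le> (\<Sum>x\<in>F'. Q * (\<Sum>e\<in>arcs_near R x. K e))"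
      using sum_mono[of F' "\<lambda>_. c", OF deep] by simp
    also have "\<dots> = Q * (\<Sum>x\<in>F'. \<Sum>e\<in>arcs_near R x. K e)"
      by (simp add: sum_distrib_left)
    also have "(\<Sum>x\<in>F'. \<Sum>e\<in>arcs_near R x. K e) \<le> real ((d + 1) ^ R) * (\<Sum>e\<in>?E. K e)"
    proof (rule sum_Union_le_multiplicity)
      fix e
      have "{x \<in> F'. e \<in> arcs_near R x} \<subseteq> nball R (fst e)"
        using nball_sym by (auto simp: arcs_near_def)
      then show "card {x \<in> F'. e \<in> arcs_near R x} \<le> (d + 1) ^ R"
        using card_mono[OF finite_nball] card_nball[of R "fst e"] order_trans by blast
    qed (use F' F finite_arcs_in sub K(1) in auto)
    also have "\<dots> \<le> real ((d + 1) ^ R) * real (card ?B)"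
      by (intro mult_left_mono K(2)) simp
    finally have "real (card F') * c \<le> Q * (real ((d + 1) ^ R) * real (card ?B))"
      using Q by (simp add: mult_left_mono)
    then have F'_le: "real (card F') \<le> Q * real ((d + 1) ^ R) / c * real (card ?B)"
      using c by (simp add: field_simps)
    have "F = F' \<union> {x \<in> F. \<not> nball (Suc R) x \<subseteq> F}" by (auto simp: F'_def)
    then have "card F \<le> card F' + card {x \<in> F. \<not> nball (Suc R) x \<subseteq> F}"
      using card_Un_le by metis
    also have "\<dots> \<le> card F' + card ?B * (d + 1) ^ Suc R"
      by (intro add_left_mono card_near_boundary F(1))
    finally have "real (card F) \<le> real (card F') + real (card ?B) * real ((d + 1) ^ Suc R)"
      by (metis of_nat_add of_nat_le_iff of_nat_mult)
    then show "real (card F) \<le> C * real (card ?B)"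
      using F'_le by (simp add: C_def algebra_simps)
  qed
qed

end

section \<open>Quasi-isomorphisms of graphs\<close>

context bounded_degree_graph
begin

lemma bounded_valency_parcs: "\<exists>d. bounded_valency_relation (parcs G) d"
proof -
  obtain d where d: "\<And>x. x \<in> pverts G \<Longrightarrow> finite (out_arcs G x) \<and> out_degree G x \<le> d"
    using bounded_degree by blast
  have "finite (parcs G `` {x}) \<and> card (parcs G `` {x}) \<le> d" for x
  proof (cases "x \<in> pverts G")
    case True
    have img: "parcs G `` {x} = snd ` out_arcs G x"
      by (force simp: out_arcs_def)
    have "card (snd ` out_arcs G x) \<le> d"
      using d[OF True] card_image_le[of "out_arcs G x" snd] by (simp add: out_degree_def)
    then show ?thesis unfolding img using d[OF True] by simp
  next
    case False
    then have none: "parcs G `` {x} = {}" using in_arcsD1 by blast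
    show ?thesis unfolding none by simp
  qed
  moreover have "sym (parcs G)"
    using pair_sym_arcs by (simp add: symmetric_def)
  ultimately show ?thesis
    by (auto simp: bounded_valency_relation_def)
qed

lemma ex_awalk:
  assumes "x \<in> pverts G" "y \<in> pverts G"
  shows "\<exists>p. awalk x p y"
proof -
  have "strongly_connected G"
    using symmetric_connected_imp_strongly_connected pair_sym_arcs connected_G by simp
  then show ?thesis
    using assms reachable_awalk by (auto simp: strongly_connected_def)
qed

lemma pverts_nonempty: "pverts G \<noteq> {}"
  using symmetric_connected_imp_strongly_connected[OF pair_sym_arcs connected_G]
  by (simp add: strongly_connected_def)

end

locale bounded_degree_graph_valency =
  bounded_degree_graph G + bounded_valency_relation "parcs G" d
  for G :: "'a pair_pre_digraph" and d :: nat
begin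

lemma nball_iff_awalk:
  assumes "x \<in> pverts G"
  shows "y \<in> nball n x \<longleftrightarrow> (\<exists>p. awalk x p y \<and> length p \<le> n)"
proof
  show "\<exists>p. awalk x p y \<and> length p \<le> n" if "y \<in> nball n x"
    using that
  proof (induction n arbitrary: y)
    case 0
    then show ?case using assms by (auto simp: awalk_Nil_iff)
  next
    case (Suc n)
    then obtain z where z: "z \<in> nball n x" "y = z \<or> (z, y) \<in> parcs G"
      by (auto simp: nball_Suc)
    then obtain p where p: "awalk x p z" "length p \<le> n" using Suc.IH by blast
    show ?case
    proof (cases "y = z")
      case True
      then show ?thesis using p by (auto intro!: exI[of _ p])
    next
      case False
      with z have "awalk z [(z, y)] y"
        using in_arcsD1 in_arcsD2 by (simp add: awalk_Cons_iff awalk_Nil_iff)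
      then have "awalk x (p @ [(z, y)]) y" using p by (intro awalk_appendI)
      then show ?thesis using p by (intro exI[of _ "p @ [(z, y)]"]) simp
    qed
  qed
next
  have "y \<in> nball (length p) x" if "awalk x p y" for p
    using that assms
  proof (induction p arbitrary: x)
    case Nil
    then show ?case by (simp add: awalk_Nil_iff)
  next
    case (Cons e p)
    then have e: "e \<in> parcs G" "fst e = x" "awalk (snd e) p y"
      by (simp_all add: awalk_Cons_iff)
    then have "y \<in> nball (length p) (snd e)"
      using Cons.IH arc_snd_in_verts by blast
    moreover have "snd e \<in> nball (Suc 0) x"
      using e by (cases e) (auto intro: arc_in_nball)
    ultimately show ?case using nball_trans by fastforce
  qed
  then show "y \<in> nball n x" if "\<exists>p. awalk x p y \<and> length p \<le> n"
    using that nball_mono by blast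
qed

text \<open>Connectedness makes the set of walks nonempty, so that the infimum is attained.\<close>

lemma graph_dist_le_iff:
  assumes "x \<in> pverts G" "y \<in> pverts G"
  shows "graph_dist G x y \<le> n \<longleftrightarrow> y \<in> nball n x"
proof -
  have "length ` {p. awalk x p y} \<noteq> {}" using ex_awalk[OF assms] by blast
  then have "graph_dist G x y \<in> length ` {p. awalk x p y}"
    unfolding graph_dist_def by (rule Inf_nat_def1)
  moreover have "graph_dist G x y \<le> length p" if "awalk x p y" for p
    unfolding graph_dist_def using that by (intro cInf_lower) auto
  ultimately show ?thesis
    unfolding nball_iff_awalk[OF assms(1)] by (auto intro: order_trans)
qed

lemma Domain_subset_pverts: "Domain (parcs G) \<subseteq> pverts G"
  using in_arcsD1 by blast

text \<open>The distortion bound in terms of balls, with a natural number \<open>N\<close> in place of \<open>k\<close> so that it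
  is common to all the quasi-isomorphisms.\<close>

lemma quasi_isomorphism_nball:
  assumes f: "quasi_isomorphism k G G f" and k: "k \<le> real N"
    and xy: "x \<in> pverts G" "y \<in> pverts G"
  shows "y \<in> nball n x \<Longrightarrow> f y \<in> nball (N * n) (f x)"
    and "f y \<in> nball n (f x) \<Longrightarrow> y \<in> nball (N * (n + 1)) x"
proof -
  have fV: "f x \<in> pverts G" "f y \<in> pverts G" and kpos: "k > 0"
    using f xy by (auto simp: quasi_isomorphism_def)
  let ?d = "graph_dist G x y" and ?d' = "graph_dist G (f x) (f y)"
  have up: "real ?d' \<le> k * real ?d" and low: "1 / k * real ?d - 1 < real ?d'"
    using f xy by (simp_all add: quasi_isomorphism_def)
  show "f y \<in> nball (N * n) (f x)" if "y \<in> nball n x"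
  proof -
    have "real ?d' \<le> real N * real n"
      using up mult_mono[of k "real N" "real ?d" "real n"] k kpos that graph_dist_le_iff[OF xy]
      by simp
    then have "?d' \<le> N * n" by (metis of_nat_le_iff of_nat_mult)
    then show ?thesis using graph_dist_le_iff[OF fV] by simp
  qed
  show "y \<in> nball (N * (n + 1)) x" if "f y \<in> nball n (f x)"
  proof -
    have "real ?d < k * (real ?d' + 1)"
      using low kpos by (simp add: field_simps)
    also have "\<dots> \<le> real N * (real n + 1)"
      using k kpos that graph_dist_le_iff[OF fV, of n] by (intro mult_mono) auto
    finally have "real ?d \<le> real (N * (n + 1))" by (simp add: algebra_simps)
    then have "?d \<le> N * (n + 1)" by (simp only: of_nat_le_iff)
    then show ?thesis using graph_dist_le_iff[OF xy] by simp
  qed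
qed

text \<open>The coarse inverse \<open>h\<close> picks for each \<open>y\<close> a point whose image under \<open>f\<close> is within distance
  \<open>N\<close> of \<open>y\<close>; the lower distortion bound of \<open>f\<close> turns closeness of images into closeness of
  points. The constant \<open>L\<close> comes from two adjacent vertices: the images under \<open>f\<close> of their
  chosen points are at distance at most \<open>2 N + 1\<close>.\<close>

lemma quasi_isomorphism_coarse_inverse:
  assumes f: "quasi_isomorphism k G G f" and k: "k \<le> real N"
    and x: "x \<in> pverts G"
  defines "L \<equiv> N * (2 * N + 2)"
  shows "\<exists>h. coarse_map L f \<and> coarse_map L h \<and>
    (\<forall>y \<in> Domain (parcs G). f (h y) \<in> nball L y) \<and>
    (\<forall>y \<in> Domain (parcs G). \<forall>n. y \<in> nball n (f x) \<longrightarrow> h y \<in> nball (N * (n + N + 1)) x)"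
proof -
  have fV: "f y \<in> pverts G" if "y \<in> pverts G" for y
    using f that by (auto simp: quasi_isomorphism_def)
  have "\<exists>z \<in> pverts G. f z \<in> nball N y" if y: "y \<in> pverts G" for y
  proof -
    obtain z where z: "z \<in> pverts G" "real (graph_dist G y (f z)) < k"
      using f y by (auto simp: quasi_isomorphism_def)
    then have "graph_dist G y (f z) \<le> N" using k by linarith
    then show ?thesis using z(1) graph_dist_le_iff[OF y fV] by auto
  qed
  then obtain h where h: "\<And>y. y \<in> pverts G \<Longrightarrow> h y \<in> pverts G"
    and fh: "\<And>y. y \<in> pverts G \<Longrightarrow> f (h y) \<in> nball N y"
    by metis
  note q = quasi_isomorphism_nball[OF f k]
  have arcV: "x \<in> pverts G" "y \<in> pverts G" if "(x, y) \<in> parcs G" for x y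
    using that in_arcsD1 in_arcsD2 by blast+
  have NL: "nball m y \<subseteq> nball L y" if "m \<le> L" for m y
    using that by (rule nball_mono)
  have bounds: "N \<le> L" "N * (0 + 1) \<le> L" "N + N \<le> L" "N * (N + (1 + N) + 1) \<le> L"
    by (auto simp: L_def algebra_simps)
  have "coarse_map L f"
    unfolding coarse_map_def
  proof safe
    fix y z assume yz: "(y, z) \<in> parcs G"
    then have "f z \<in> nball (N * Suc 0) (f y)"
      using arcV[OF yz] arc_in_nball by (intro q(1)) auto
    then show "f z \<in> nball L (f y)" using NL[OF bounds(1)] by auto
  next
    fix y y' z z' assume yz: "(y, y') \<in> parcs G" "(z, z') \<in> parcs G" "f y = f z"
    then have "z \<in> nball (N * (0 + 1)) y"
      using arcV by (intro q(2)) auto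
    then show "z \<in> nball L y" using NL[OF bounds(2)] by blast
  qed
  moreover have "coarse_map L h"
    unfolding coarse_map_def
  proof safe
    fix y z assume yz: "(y, z) \<in> parcs G"
    have "y \<in> nball N (f (h y))" using fh arcV[OF yz] nball_sym by blast
    moreover have "f (h z) \<in> nball (1 + N) y"
      using nball_trans[of z 1 y] arc_in_nball[OF yz] fh arcV[OF yz] by simp
    ultimately have "f (h z) \<in> nball (N + (1 + N)) (f (h y))" by (rule nball_trans)
    then have "h z \<in> nball (N * (N + (1 + N) + 1)) (h y)"
      using h arcV[OF yz] by (intro q(2)) auto
    then show "h z \<in> nball L (h y)" using NL[OF bounds(4)] by blast
  next
    fix y y' z z' assume yz: "(y, y') \<in> parcs G" "(z, z') \<in> parcs G" "h y = h z"
    have "f (h y) \<in> nball N y" by (rule fh[OF arcV(1)[OF yz(1)]])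
    moreover have "z \<in> nball N (f (h y))"
      using fh[OF arcV(1)[OF yz(2)]] nball_sym[of z] yz(3) by simp
    ultimately have "z \<in> nball (N + N) y" by (rule nball_trans)
    then show "z \<in> nball L y" using NL[OF bounds(3)] by blast
  qed
  moreover have "f (h y) \<in> nball L y" if "y \<in> Domain (parcs G)" for y
    using fh[of y] that Domain_subset_pverts NL[OF bounds(1)] by blast
  moreover have "h y \<in> nball (N * (n + N + 1)) x"
    if "y \<in> Domain (parcs G)" "y \<in> nball n (f x)" for y n
  proof -
    have y: "y \<in> pverts G" using that(1) Domain_subset_pverts by blast
    have "f (h y) \<in> nball (n + N) (f x)" using that(2) fh[OF y] by (rule nball_trans)
    then show ?thesis using x h[OF y] by (intro q(2)) auto
  qed
  ultimately show ?thesis by blast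
qed

lemma HD_finite_energy: "v \<in> HD G \<Longrightarrow> finite_energy v"
  by (simp add: HD_def dirichlet_function_def l2_def finite_energy_def)

lemma HD_harmonic:
  assumes "v \<in> HD G"
  shows "(\<Sum>y \<in> parcs G `` {x}. v y - v x) = 0"
proof (cases "x \<in> pverts G")
  case True
  then have "(\<Sum>y \<in> {y. (x, y) \<in> parcs G}. differential v (x, y)) = 0"
    using assms by (simp add: HD_def flow_def del: differential_pair)
  moreover have "parcs G `` {x} = {y. (x, y) \<in> parcs G}" by auto
  ultimately show ?thesis by simp
next
  case False
  then have none: "parcs G `` {x} = {}" using in_arcsD1 by blast
  show ?thesis unfolding none by simp
qed

lemma constant_on_if_energy_eq_0:
  assumes fin: "finite_energy v" and zero: "energy v = 0"
  shows "v constant_on pverts G"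
proof -
  have arc0: "(differential v e)\<^sup>2 = 0" if "e \<in> parcs G" for e
    using fin zero that nonneg_infsum_le_0D[of "\<lambda>e. (differential v e)\<^sup>2" "parcs G" e]
    by (simp add: finite_energy_def energy_def)
  obtain x0 where x0: "x0 \<in> pverts G" using pverts_nonempty by blast
  have "v y = v x0" if y: "y \<in> pverts G" for y
  proof -
    have "y \<in> nball (graph_dist G x0 y) x0" using graph_dist_le_iff[OF x0 y] by blast
    from sq_diff_le_energy_near[OF this, of v] have "(v y - v x0)\<^sup>2 \<le> 0"
      by (simp add: arc0 arcs_near_def)
    then show ?thesis by simp
  qed
  then show ?thesis by (auto simp: constant_on_def)
qed

lemma nonconstant_HD_imp_isoperimetric:
  assumes qt: "quasi_transitive G" and v: "v \<in> HD G" and nonconst: "\<not> v constant_on pverts G"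
  obtains C :: real where "C > 0"
    and "\<And>F. finite F \<Longrightarrow> F \<subseteq> pverts G \<Longrightarrow> real (card F) \<le> C * real (card (inner_boundary F))"
proof -
  obtain x0 where x0: "x0 \<in> pverts G" using pverts_nonempty by blast
  obtain K where K: "\<And>x y. x \<in> pverts G \<Longrightarrow> y \<in> pverts G \<Longrightarrow>
      \<exists>f k. k \<le> K \<and> quasi_isomorphism k G G f \<and> f x = y"
    using qt unfolding quasi_transitive_def by blast
  define N where "N = nat \<lceil>K\<rceil>"
  have KN: "K \<le> real N" unfolding N_def by (rule real_nat_ceiling_ge)
  have pos: "energy v > 0"
    using constant_on_if_energy_eq_0[OF HD_finite_energy[OF v]] nonconst energy_nonneg[of v] by force
  have conn: "\<exists>n. y \<in> nball n x0" if "y \<in> Domain (parcs G)" for y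
    using that Domain_subset_pverts graph_dist_le_iff[OF x0, of y] by blast
  have hom: "\<exists>f h. coarse_map (N * (2 * N + 2)) f \<and> coarse_map (N * (2 * N + 2)) h \<and>
      (\<forall>y \<in> Domain (parcs G). f (h y) \<in> nball (N * (2 * N + 2)) y) \<and>
      (\<forall>y \<in> Domain (parcs G). \<forall>n. y \<in> nball n x0 \<longrightarrow> h y \<in> nball (N * (n + N + 1)) x)"
    if x: "x \<in> pverts G" for x
  proof -
    obtain f k where "k \<le> K" and f: "quasi_isomorphism k G G f" "f x = x0"
      using K[OF x x0] by blast
    then have "k \<le> real N" using KN by simp
    from quasi_isomorphism_coarse_inverse[OF f(1) this x] show ?thesis
      unfolding f(2) by (rule exI[where x = f])
  qed
  show thesis
    using strong_isoperimetric_inequality[OF HD_finite_energy[OF v] HD_harmonic[OF v] pos conn hom] that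
    by blast
qed

end

theorem theorem9:
  fixes G :: "'a pair_pre_digraph"
  assumes "bounded_degree_graph G"
    and "quasi_transitive G"
    and "amenable G"
  shows "\<forall>v \<in> HD G. v constant_on pverts G"
proof (rule ballI, rule ccontr)
  fix v assume v: "v \<in> HD G" and nonconst: "\<not> v constant_on pverts G"
  obtain d where d: "bounded_valency_relation (parcs G) d"
    using bounded_degree_graph.bounded_valency_parcs[OF assms(1)] by blast
  interpret bounded_degree_graph_valency G d
    using assms(1) d by (simp add: bounded_degree_graph_valency_def)
  obtain C :: real where C: "C > 0" and
    iso: "\<And>F. finite F \<Longrightarrow> F \<subseteq> pverts G \<Longrightarrow> real (card F) \<le> C * real (card (inner_boundary F))"
    using nonconstant_HD_imp_isoperimetric[OF assms(2) v nonconst] by blast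
  have "(INF H \<in> {H. full_subgraph H G \<and> finite (pverts H)}.
      ereal (real (card (vertex_boundary G H)) / real (card (pverts H)))) < ereal (1 / C)"
    using assms(3) C by (simp add: amenable_def)
  then obtain H where H: "full_subgraph H G" "finite (pverts H)"
    and small: "real (card (vertex_boundary G H)) / real (card (pverts H)) < 1 / C"
    by (auto simp: INF_less_iff)
  have sub: "pverts H \<subseteq> pverts G" and wfH: "wf_digraph H"
    using H(1) by (auto simp: full_subgraph_def induced_subgraph_def subgraph_def)
  have "pverts H \<noteq> {}"
    using H(1) wf_digraph.tail_in_verts[OF wfH] by (auto simp: full_subgraph_def)
  then have "real (card (pverts H)) > 0" using H(2) by (simp add: card_gt_0_iff)
  moreover have "vertex_boundary G H = inner_boundary (pverts H)"
    by (simp add: vertex_boundary_def inner_boundary_def)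
  ultimately show False
    using iso[OF H(2) sub] small C by (simp add: field_simps)
qed

end
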